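(* Let $\mathbb{X}$ be a finite-dimensional real Banach space. Then the following statements are equivalent: (1) For every linear operator $T:\mathbb{X}\to\mathbb{X}$, $M_T$ is the unit sphere of some subspace of $\mathbb{X}$. (2) For every linear operator $T:\mathbb{X}\to\mathbb{X}$, $M_T=D_T\cup(-D_T)$, where $D_T$ is a connected subset of $S_{\mathbb{X}}$. (3) $\mathbb{X}$ is a Euclidean space.
   Context: All normed spaces are real. $S_{\mathbb{X}}=\{x\in\mathbb{X}:\|x\|=1\}$. For a bounded linear operator $T$, $M_T=\{x\in S_{\mathbb{X}}:\|Tx\|=\|T\|\}$, where $\|T\|$ is the operator norm. A Euclidean space is a finite-dimensional Hilbert space, i.e. the norm of $\mathbb{X}$ is induced by an inner product. *)

theory Defs
  imports "HOL-Analysis.Analysis"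
begin

definition norm_attainment_set ::
    "('a::real_normed_vector \<Rightarrow> 'b::real_normed_vector) \<Rightarrow> 'a set"
  where "norm_attainment_set T = {x \<in> sphere 0 1. norm (T x) = onorm T}"

definition is_inner_product :: "('a::real_vector \<Rightarrow> 'a \<Rightarrow> real) \<Rightarrow> bool"
  where "is_inner_product ip \<longleftrightarrow>
    bilinear ip \<and> (\<forall>x y. ip x y = ip y x) \<and> (\<forall>x. x \<noteq> 0 \<longrightarrow> ip x x > 0)"

(* The inner product is existentially quantified, not taken from class real_inner: whether
   the given norm of the type comes from an inner product has to be a proposition. *)
definition norm_induced_by_inner_product :: "'a::real_normed_vector itself \<Rightarrow> bool"
  where "norm_induced_by_inner_product _ \<longleftrightarrow>
    (\<exists>ip::'a \<Rightarrow> 'a \<Rightarrow> real. is_inner_product ip \<and> (\<forall>x. norm x = sqrt (ip x x)))"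

definition finite_dimensional :: "'a::real_vector itself \<Rightarrow> bool"
  where "finite_dimensional _ \<longleftrightarrow> (\<exists>B::'a set. finite B \<and> span B = UNIV)"

(* Completeness is automatic in finite dimension, so a Euclidean space (a finite-dimensional
   Hilbert space) needs no separate completeness clause. *)
definition is_euclidean_space :: "'a::real_normed_vector itself \<Rightarrow> bool"
  where "is_euclidean_space X \<longleftrightarrow> finite_dimensional X \<and> norm_induced_by_inner_product X"

end

theory Submission
  imports Defs
begin

text \<open>
  The implication from (3) to (1) is the parallelogram law for the nonnegative form
  \<open>\<parallel>T\<parallel>\<^sup>2 \<parallel>x\<parallel>\<^sup>2 - \<parallel>T x\<parallel>\<^sup>2\<close>, whose zeros form a subspace, and the one from (1) to (2)
  is connectedness of spheres.

  For (2) implies (3) it suffices that every plane \<open>Y\<close> in \<open>X\<close> is Euclidean, so consider the operators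
  \<open>X \<rightarrow> \<real>\<^sup>2 \<rightarrow> Y\<close> through a fixed projection of \<open>X\<close> onto \<open>\<real>\<^sup>2\<close>. They are the linear maps
  \<open>L\<close> from the projected ball \<open>K\<close> to the normed plane \<open>Y\<close>, and (2) says that the points where \<open>L\<close> attains its
  norm are connected up to sign. Let \<open>L\<close> maximise a linear functional with nonsingular matrix \<open>P\<close> on the
  unit ball of these maps. Then neither the contact points nor the norming functionals of \<open>L\<close>
  are all parallel. If some direction carried no contact point, the contact points would form an
  arc with end points \<open>a\<close> and \<open>b\<close>, and \<open>L\<close> could be perturbed so that the contact points
  survive only near \<open>a\<close> and near \<open>b\<close>; moving the perturbation from one favouring \<open>a\<close> to one favouring \<open>b\<close>,
  some operator in between has contact points near both but none in the middle, contradicting (2).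
  Hence \<open>L\<close> maps \<open>K\<close> onto the unit ball of \<open>Y\<close>. Approximating rank one matrices by
  nonsingular ones, for every unit vector \<open>x\<close> of \<open>Y\<close> and every norming functional \<open>f\<close> there is an isometry
  \<open>G\<close> of \<open>Y\<close> with \<open>f (G x) = 1\<close>. The isometries preserve the
  quadratic form of the Loewner ellipse, and taking for \<open>f\<close> the functional given by this form at a
  unit vector on which it is largest shows that the form is constant on the unit sphere of \<open>Y\<close>.
\<close>

section \<open>Linear maps of the plane\<close>

type_synonym plane = "real \<times> real"

text \<open>A matrix is stored as the pair of its rows, so that the inner product on
  \<open>plane \<times> plane\<close> is the trace pairing of matrices, and limits and compactness
  come with the type.\<close>

definition mv :: "plane \<times> plane \<Rightarrow> plane \<Rightarrow> plane"
  where "mv L p = (fst L \<bullet> p, snd L \<bullet> p)"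

definition rank_one :: "plane \<Rightarrow> plane \<Rightarrow> plane \<times> plane"
  where "rank_one y l = (fst y *\<^sub>R l, snd y *\<^sub>R l)"

lemma mv_linear: "linear (mv L)"
  by (rule linearI) (auto simp: mv_def inner_add_right)

lemma mv_add_left: "mv (L + M) p = mv L p + mv M p"
  and mv_scaleR_left: "mv (c *\<^sub>R L) p = c *\<^sub>R mv L p"
  and mv_diff_left: "mv (L - M) p = mv L p - mv M p"
  by (simp_all add: mv_def inner_add_left inner_diff_left)

lemmas mv_add = linear_add[OF mv_linear] and mv_scaleR = linear_scale[OF mv_linear]
  and mv_diff = linear_diff[OF mv_linear] and mv_minus = linear_neg[OF mv_linear]
  and mv_zero = linear_0[OF mv_linear]

lemma mv_rank_one: "mv (rank_one y l) p = (l \<bullet> p) *\<^sub>R y"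
  by (simp add: mv_def rank_one_def prod_eq_iff)

lemma tendsto_mv [tendsto_intros]:
  "(L \<longlongrightarrow> L0) G \<Longrightarrow> (p \<longlongrightarrow> p0) G \<Longrightarrow> ((\<lambda>x. mv (L x) (p x)) \<longlongrightarrow> mv L0 p0) G"
  unfolding mv_def by (intro tendsto_intros)

lemma continuous_on_mv [continuous_intros]:
  "continuous_on S L \<Longrightarrow> continuous_on S p \<Longrightarrow> continuous_on S (\<lambda>x. mv (L x) (p x))"
  unfolding mv_def by (intro continuous_intros)

lemma linear_plane_eq_mv:
  assumes "linear (G :: plane \<Rightarrow> plane)"
  obtains L where "G = mv L"
proof
  show "G = mv ((fst (G (1,0)), fst (G (0,1))), (snd (G (1,0)), snd (G (0,1))))"
  proof
    fix p :: plane
    have "G p = G (fst p *\<^sub>R (1,0) + snd p *\<^sub>R (0,1))" by (simp add: prod_eq_iff)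
    also have "\<dots> = fst p *\<^sub>R G (1,0) + snd p *\<^sub>R G (0,1)"
      by (simp only: linear_add[OF assms] linear_scale[OF assms])
    finally show "G p = mv ((fst (G (1,0)), fst (G (0,1))), (snd (G (1,0)), snd (G (0,1)))) p"
      by (simp add: mv_def prod_eq_iff inner_prod_def mult.commute)
  qed
qed

section \<open>Determinants and dual bases\<close>

definition cross :: "plane \<Rightarrow> plane \<Rightarrow> real"
  where "cross a b = fst a * snd b - snd a * fst b"

lemma cross_eq_0_imp:
  assumes "cross a b = 0" "a \<noteq> 0"
  obtains c where "b = c *\<^sub>R a"
proof (cases "fst a = 0")
  case True
  then have "snd a \<noteq> 0" using assms(2) by (simp add: prod_eq_iff)
  with True assms(1) show ?thesis
    by (intro that[of "snd b / snd a"]) (auto simp: cross_def prod_eq_iff)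
next
  case False
  with assms(1) show ?thesis
    by (intro that[of "fst b / fst a"]) (auto simp: cross_def prod_eq_iff field_simps)
qed

lemma cross_scaleR [simp]: "cross (c *\<^sub>R a) b = c * cross a b" "cross a (c *\<^sub>R b) = c * cross a b"
  and cross_add [simp]: "cross (a + a') b = cross a b + cross a' b" "cross a (b + b') = cross a b + cross a b'"
  and cross_self [simp]: "cross a a = 0"
  and cross_minus [simp]: "cross (- a) b = - cross a b" "cross a (- b) = - cross a b"
  and cross_zero [simp]: "cross 0 b = 0" "cross a 0 = 0"
  by (auto simp: cross_def algebra_simps)

text \<open>Cramer's rule: \<open>a'\<close> and \<open>b'\<close> are the rows of the inverse of
  the matrix with columns \<open>a\<close> and \<open>b\<close>.\<close>

lemma dual_basis:
  assumes "cross a b \<noteq> 0"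
  obtains a' b' where "a' \<bullet> a = 1" "a' \<bullet> b = 0" "b' \<bullet> a = 0" "b' \<bullet> b = 1"
    "\<And>p. p = (a' \<bullet> p) *\<^sub>R a + (b' \<bullet> p) *\<^sub>R b"
proof -
  define D where "D = cross a b"
  have D: "D \<noteq> 0" "D = fst a * snd b - snd a * fst b" using assms by (auto simp: D_def cross_def)
  show ?thesis
  proof (rule that[of "(snd b / D, - fst b / D)" "(- snd a / D, fst a / D)"])
    show "(snd b / D, - fst b / D) \<bullet> a = 1" "(- snd a / D, fst a / D) \<bullet> b = 1"
      using D by (simp_all add: inner_prod_def field_simps)
    show "(snd b / D, - fst b / D) \<bullet> b = 0" "(- snd a / D, fst a / D) \<bullet> a = 0"
      using D(1) by (simp_all add: inner_prod_def field_simps)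
    fix p :: plane
    have "fst p * D = (snd b * fst p - fst b * snd p) * fst a + (fst a * snd p - snd a * fst p) * fst b"
      "snd p * D = (snd b * fst p - fst b * snd p) * snd a + (fst a * snd p - snd a * fst p) * snd b"
      unfolding D(2) by algebra+
    then have "fst p = (snd b * fst p - fst b * snd p) / D * fst a + (fst a * snd p - snd a * fst p) / D * fst b"
      "snd p = (snd b * fst p - fst b * snd p) / D * snd a + (fst a * snd p - snd a * fst p) / D * snd b"
      using D(1) by (simp_all only: eq_divide_eq times_divide_eq_left add_divide_distrib[symmetric]) simp_all
    moreover have "(snd b / D, - fst b / D) \<bullet> p = (snd b * fst p - fst b * snd p) / D"
      "(- snd a / D, fst a / D) \<bullet> p = (fst a * snd p - snd a * fst p) / D"
      by (simp_all add: inner_prod_def diff_divide_distrib)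
    ultimately show "p = ((snd b / D, - fst b / D) \<bullet> p) *\<^sub>R a + ((- snd a / D, fst a / D) \<bullet> p) *\<^sub>R b"
      unfolding prod_eq_iff by (simp only: fst_add snd_add fst_scaleR snd_scaleR real_scaleR_def)
  qed
qed

section \<open>Contact points\<close>

text \<open>\<open>K\<close> plays the role of the unit ball of the domain and \<open>F\<close> that of the dual unit ball of the target, so that the
  norm of \<open>mv L\<close> is the maximum of \<open>f \<bullet> mv L p\<close> over \<open>K \<times> F\<close>.\<close>

locale body_pair =
  fixes K F :: "plane set" and \<delta> :: real
  assumes compact_K: "compact K" and convex_K: "convex K" and sym_K: "p \<in> K \<Longrightarrow> - p \<in> K"
    and compact_F: "compact F" and sym_F: "f \<in> F \<Longrightarrow> - f \<in> F"
    and delta: "\<delta> > 0" "cball 0 \<delta> \<subseteq> K" "cball 0 \<delta> \<subseteq> F"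
begin

text \<open>The point is kept together with a norming functional because the first-order effect of a
  perturbation depends on both. The maximum is not normalised, so perturbed operators need no
  rescaling.\<close>

definition contact :: "plane \<times> plane \<Rightarrow> plane \<Rightarrow> plane \<Rightarrow> bool"
  where "contact L p f \<longleftrightarrow> p \<in> K \<and> f \<in> F \<and> (\<forall>p'\<in>K. \<forall>f'\<in>F. f' \<bullet> mv L p' \<le> f \<bullet> mv L p)"

lemma contact_ex: "\<exists>p f. contact L p f"
proof -
  have "continuous_on (K \<times> F) (\<lambda>z. snd z \<bullet> mv L (fst z))" by (intro continuous_intros)
  moreover have "K \<times> F \<noteq> {}" "compact (K \<times> F)"
    using delta by (auto intro: compact_Times compact_K compact_F)
  ultimately obtain z where "z \<in> K \<times> F" "\<forall>y\<in>K \<times> F. snd y \<bullet> mv L (fst y) \<le> snd z \<bullet> mv L (fst z)"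
    using continuous_attains_sup by blast
  then show ?thesis unfolding contact_def by (metis mem_Times_iff fst_conv snd_conv)
qed

lemma contact_uminus: "contact L p f \<Longrightarrow> contact L (- p) (- f)"
  unfolding contact_def mv_minus inner_minus_left inner_minus_right minus_minus
  using sym_K sym_F by blast

lemma contact_cong: "contact L p f \<Longrightarrow> contact L p' f' \<Longrightarrow> f \<bullet> mv L p = f' \<bullet> mv L p'"
  unfolding contact_def by (meson antisym)

lemma contact_limit:
  assumes "L \<longlonglongrightarrow> L0" "p \<longlonglongrightarrow> p0" "f \<longlonglongrightarrow> f0" "\<And>n. contact (L n) (p n) (f n)"
  shows "contact L0 p0 f0"
  unfolding contact_def
proof (intro conjI ballI)
  show "p0 \<in> K" "f0 \<in> F"
    using closed_sequentially[OF compact_imp_closed[OF compact_K] _ assms(2)]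
      closed_sequentially[OF compact_imp_closed[OF compact_F] _ assms(3)] assms(4)
    unfolding contact_def by blast+
  fix p' f' assume "p' \<in> K" "f' \<in> F"
  then have "\<And>n. f' \<bullet> mv (L n) p' \<le> f n \<bullet> mv (L n) (p n)" using assms(4) by (auto simp: contact_def)
  moreover have "(\<lambda>n. f' \<bullet> mv (L n) p') \<longlonglongrightarrow> f' \<bullet> mv L0 p'"
    "(\<lambda>n. f n \<bullet> mv (L n) (p n)) \<longlonglongrightarrow> f0 \<bullet> mv L0 p0"
    by (intro tendsto_intros assms)+
  ultimately show "f' \<bullet> mv L0 p' \<le> f0 \<bullet> mv L0 p0" by (meson LIMSEQ_le)
qed

section \<open>Contact points along paths of operators\<close>

lemma subsequence:
  fixes r :: "nat \<Rightarrow> real"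
  assumes "\<And>n. r n \<in> {a..b}" "\<And>n. p n \<in> K" "\<And>n. f n \<in> F"
  obtains \<sigma> r0 p0 f0 where "strict_mono (\<sigma> :: nat \<Rightarrow> nat)" "r0 \<in> {a..b}" "p0 \<in> K" "f0 \<in> F"
    "(\<lambda>n. r (\<sigma> n)) \<longlonglongrightarrow> r0" "(\<lambda>n. p (\<sigma> n)) \<longlonglongrightarrow> p0" "(\<lambda>n. f (\<sigma> n)) \<longlonglongrightarrow> f0"
proof -
  have "seq_compact ({a..b} \<times> K \<times> F)"
    by (intro compact_imp_seq_compact compact_Times compact_K compact_F compact_Icc)
  moreover have "\<forall>n. (r n, p n, f n) \<in> {a..b} \<times> K \<times> F" using assms by auto
  ultimately obtain l \<sigma> where *: "l \<in> {a..b} \<times> K \<times> F" "strict_mono \<sigma>"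
    "((\<lambda>n. (r n, p n, f n)) \<circ> \<sigma>) \<longlonglongrightarrow> l" by (rule seq_compactE)
  show ?thesis
    using * tendsto_fst[OF *(3)] tendsto_fst[OF tendsto_snd[OF *(3)]] tendsto_snd[OF tendsto_snd[OF *(3)]]
    by (intro that[of \<sigma> "fst l" "fst (snd l)" "snd (snd l)"]) (auto simp: o_def)
qed

text \<open>For even \<open>h\<close> the zero set of \<open>h\<close> then cuts the contact points
  into two nonempty symmetric pieces, which connectedness up to sign forbids.\<close>

definition separates :: "(plane \<Rightarrow> real) \<Rightarrow> plane \<times> plane \<Rightarrow> bool"
  where "separates h L \<longleftrightarrow> (\<forall>p f. contact L p f \<longrightarrow> h p \<noteq> 0) \<and>
    (\<exists>p f. contact L p f \<and> h p < 0) \<and> (\<exists>p f. contact L p f \<and> h p > 0)"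

text \<open>Otherwise the parameters having a contact point with \<open>h \<ge> 0\<close> and those
  having one with \<open>h \<le> 0\<close> form two closed sets that cover the interval, are
  disjoint since \<open>h\<close> separates no operator, and are nonempty because of the end points.
  This contradicts connectedness of the interval.\<close>

lemma crossing_contact:
  fixes M :: "real \<Rightarrow> plane \<times> plane"
  assumes M: "continuous_on {-1..1} M" and h: "continuous_on UNIV h" "\<And>L. \<not> separates h L"
  obtains r p f where "r \<in> {-1..1}" "contact (M r) p f"
    "h p = 0 \<or> r = 1 \<and> h p \<le> 0 \<or> r = -1 \<and> h p \<ge> 0"
proof (rule ccontr)
  assume "\<not> thesis"
  then have no: "\<And>r p f. r \<in> {-1..1} \<Longrightarrow> contact (M r) p f \<Longrightarrow>
      h p \<noteq> 0 \<and> (r = 1 \<longrightarrow> h p > 0) \<and> (r = -1 \<longrightarrow> h p < 0)"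
    using that by (smt (verit))
  define A where "A s = {r \<in> {-1..1}. \<exists>p f. contact (M r) p f \<and> s * h p \<ge> 0}" for s :: real
  have clA: "closed (A s)" for s
    unfolding closed_sequential_limits
  proof (intro allI impI, elim conjE)
    fix r l assume r: "\<forall>n. r n \<in> A s" "r \<longlonglongrightarrow> l"
    then have "\<forall>n. \<exists>p f. contact (M (r n)) p f \<and> s * h p \<ge> 0" unfolding A_def by blast
    then obtain p f where pf: "\<And>n. contact (M (r n)) (p n) (f n)" "\<And>n. s * h (p n) \<ge> 0"
      by metis
    have r1: "r n \<in> {-1..1}" for n using r by (auto simp: A_def)
    obtain \<sigma> r0 p0 f0 where *: "strict_mono (\<sigma> :: nat \<Rightarrow> nat)" "r0 \<in> {-1..1}"
      "(\<lambda>n. r (\<sigma> n)) \<longlonglongrightarrow> r0" "(\<lambda>n. p (\<sigma> n)) \<longlonglongrightarrow> p0" "(\<lambda>n. f (\<sigma> n)) \<longlonglongrightarrow> f0"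
      by (rule subsequence[of r "-1" 1 p f]) (use r1 pf(1) in \<open>auto simp only: contact_def\<close>)
    have "r0 = l"
      using LIMSEQ_unique[OF *(3)] LIMSEQ_subseq_LIMSEQ[OF r(2) *(1)] by (simp add: comp_def)
    have "(\<lambda>n. M (r (\<sigma> n))) \<longlonglongrightarrow> M r0"
      using continuous_on_tendsto_compose[OF M *(3) *(2)] r1 by simp
    then have "contact (M r0) p0 f0" using contact_limit[OF _ *(4,5)] pf(1) by blast
    moreover have "(\<lambda>n. s * h (p (\<sigma> n))) \<longlonglongrightarrow> s * h p0"
      by (intro tendsto_intros continuous_on_tendsto_compose[OF h(1) *(4)]) auto
    then have "s * h p0 \<ge> 0" using pf(2) by (intro LIMSEQ_le_const) auto
    ultimately show "l \<in> A s" using *(2) \<open>r0 = l\<close> unfolding A_def by blast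
  qed
  have "A 1 \<inter> A (-1) \<inter> {-1..1} = {}"
  proof (rule ccontr)
    assume "A 1 \<inter> A (-1) \<inter> {-1..1} \<noteq> {}"
    then obtain r where "r \<in> A 1" "r \<in> A (-1)" "r \<in> {-1..1}" by blast
    then have "separates h (M r)"
      unfolding separates_def A_def using no by (fastforce simp: less_le)
    then show False using h by blast
  qed
  moreover have cover: "r \<in> A 1 \<union> A (-1)" if "r \<in> {-1..1}" for r
  proof -
    obtain p f where "contact (M r) p f" using contact_ex by blast
    moreover have "1 * h p \<ge> 0 \<or> -1 * h p \<ge> 0" by linarith
    ultimately show ?thesis unfolding A_def using that by blast
  qed
  moreover have "1 \<notin> A (-1)" "-1 \<notin> A 1"
    using no[of 1] no[of "-1"] unfolding A_def by fastforce+
  then have "1 \<in> A 1" "-1 \<in> A (-1)" using cover[of 1] cover[of "-1"] by auto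
  ultimately show False
    using connected_closedD[of "{-1..1::real}" "A 1" "A (-1)"] clA by fastforce
qed

text \<open>Limits, as \<open>\<epsilon> \<rightarrow> 0\<close>, of contact points of \<open>L + \<epsilon> M r\<close> are the contact points of \<open>L\<close> that maximise the
  first-order term.\<close>

lemma perturbed_contact:
  fixes M :: "real \<Rightarrow> plane \<times> plane"
  assumes M: "continuous_on {-1..1} M" and h: "continuous_on UNIV h" "\<And>L. \<not> separates h L"
  obtains r p f where "r \<in> {-1..1}" "contact L p f"
    "\<And>p' f'. contact L p' f' \<Longrightarrow> f' \<bullet> mv (M r) p' \<le> f \<bullet> mv (M r) p"
    "h p = 0 \<or> r = 1 \<and> h p \<le> 0 \<or> r = -1 \<and> h p \<ge> 0"
proof -
  define e where "e n = inverse (real (Suc n))" for n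
  have e: "e n > 0" for n by (simp add: e_def)
  have "\<exists>r p f. r \<in> {-1..1} \<and> contact (L + e n *\<^sub>R M r) p f \<and>
      (h p = 0 \<or> r = 1 \<and> h p \<le> 0 \<or> r = -1 \<and> h p \<ge> 0)" for n
  proof -
    have "continuous_on {-1..1} (\<lambda>r. L + e n *\<^sub>R M r)" by (intro continuous_intros M)
    from crossing_contact[OF this h] show ?thesis by blast
  qed
  then obtain r p f where r: "\<And>n. r n \<in> {-1..1}" and c: "\<And>n. contact (L + e n *\<^sub>R M (r n)) (p n) (f n)"
    and hp: "\<And>n. h (p n) = 0 \<or> r n = 1 \<and> h (p n) \<le> 0 \<or> r n = -1 \<and> h (p n) \<ge> 0"
    by metis
  obtain \<sigma> r0 p0 f0 where *: "strict_mono (\<sigma> :: nat \<Rightarrow> nat)" "r0 \<in> {-1..1}"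
    "(\<lambda>n. r (\<sigma> n)) \<longlonglongrightarrow> r0" "(\<lambda>n. p (\<sigma> n)) \<longlonglongrightarrow> p0" "(\<lambda>n. f (\<sigma> n)) \<longlonglongrightarrow> f0"
    by (rule subsequence[of r "-1" 1 p f]) (use r c in \<open>auto simp only: contact_def\<close>)
  have Mlim: "(\<lambda>n. M (r (\<sigma> n))) \<longlonglongrightarrow> M r0"
    using continuous_on_tendsto_compose[OF M *(3) *(2)] r by simp
  have elim: "(\<lambda>n. e (\<sigma> n)) \<longlonglongrightarrow> 0"
    using LIMSEQ_subseq_LIMSEQ[OF LIMSEQ_inverse_real_of_nat *(1)] by (simp add: e_def o_def)
  have "(\<lambda>n. L + e (\<sigma> n) *\<^sub>R M (r (\<sigma> n))) \<longlonglongrightarrow> L + 0 *\<^sub>R M r0"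
    by (intro tendsto_intros elim Mlim)
  then have c0: "contact L p0 f0" using contact_limit[OF _ *(4,5) c] by simp
  have "f' \<bullet> mv (M r0) p' \<le> f0 \<bullet> mv (M r0) p0" if c': "contact L p' f'" for p' f'
  proof -
    have "f' \<bullet> mv (M (r n)) p' \<le> f n \<bullet> mv (M (r n)) (p n)" for n
    proof -
      \<comment> \<open>The pair \<open>(p n, f n)\<close> beats \<open>(p', f')\<close> for the
        perturbed operator and is beaten by it for \<open>L\<close>. Adding the two inequalities
        leaves the first-order terms with a factor \<open>e n > 0\<close>.\<close>
      have "f' \<bullet> mv (L + e n *\<^sub>R M (r n)) p' \<le> f n \<bullet> mv (L + e n *\<^sub>R M (r n)) (p n)"
        "f n \<bullet> mv L (p n) \<le> f' \<bullet> mv L p'"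
        using c[of n] c' by (auto simp: contact_def)
      then have "e n * (f' \<bullet> mv (M (r n)) p') \<le> e n * (f n \<bullet> mv (M (r n)) (p n))"
        by (simp add: mv_add_left mv_scaleR_left inner_add_right)
      then show ?thesis using e[of n] by simp
    qed
    moreover have "(\<lambda>n. f' \<bullet> mv (M (r (\<sigma> n))) p') \<longlonglongrightarrow> f' \<bullet> mv (M r0) p'"
      "(\<lambda>n. f (\<sigma> n) \<bullet> mv (M (r (\<sigma> n))) (p (\<sigma> n))) \<longlonglongrightarrow> f0 \<bullet> mv (M r0) p0"
      by (intro tendsto_intros * Mlim)+
    ultimately show ?thesis by (meson LIMSEQ_le)
  qed
  moreover have "h p0 = 0 \<or> r0 = 1 \<and> h p0 \<le> 0 \<or> r0 = -1 \<and> h p0 \<ge> 0"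
  proof -
    \<comment> \<open>The three alternatives describe a closed set of pairs \<open>(r, p)\<close>,
      so they survive the limit.\<close>
    have "closed {z. h (snd z) = 0 \<or> fst z = (1::real) \<and> h (snd z) \<le> 0 \<or> fst z = -1 \<and> h (snd z) \<ge> 0}"
      by (intro closed_Collect_disj closed_Collect_conj closed_Collect_eq closed_Collect_le
          continuous_intros continuous_on_compose2[OF h(1)]) auto
    from closed_sequentially[OF this, of "\<lambda>n. (r (\<sigma> n), p (\<sigma> n))" "(r0, p0)"]
    show ?thesis using hp tendsto_Pair[OF *(3,4)] by simp
  qed
  ultimately show ?thesis using that[OF *(2) c0] by blast
qed

end

section \<open>Two clusters of contact points\<close>

text \<open>In \<open>no_two_clusters\<close>, \<open>s, t\<close> and
  \<open>\<sigma>, \<tau>\<close> are the coordinates of a contact pair, and \<open>A\<close>,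
  \<open>B\<close> the values of its functional at the images of \<open>a\<close> and
  \<open>b\<close>. The last hypothesis says that its first-order term is nonnegative. For
  \<open>t > 0\<close> the weight 3 outweighs whatever a negative \<open>B\<close> contributes, so
  every summand vanishes.\<close>

lemma cluster_estimate:
  fixes s t \<sigma> \<tau> r A B :: real
  assumes "s \<ge> 0" "t \<ge> 0" "\<sigma> \<ge> 0" "\<tau> \<ge> 0" "\<sigma> + \<tau> \<ge> 1" "s * A + t * B = 1" "B \<ge> \<tau> - \<sigma>" "0 \<le> r" "r \<le> 1"
    and "- r * (t * B) - 3 * (t * \<sigma> + s * \<tau>) \<ge> 0"
  shows "t = 0 \<or> s = 0 \<and> r = 0"
proof (cases "t = 0")
  case False
  then have t: "t > 0" using assms by simp
  have st: "t * \<sigma> \<ge> 0" "s * \<tau> \<ge> 0" using assms by auto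
  have eq: "- r * (t * B) - 3 * (t * \<sigma> + s * \<tau>) = - (r * (t * B)) - 3 * (t * \<sigma>) - 3 * (s * \<tau>)"
    by (simp add: algebra_simps)
  have B: "B \<ge> 0"
  proof (rule ccontr)
    assume "\<not> B \<ge> 0"
    then have "- B \<le> \<sigma>" "\<sigma> > 0" "- B > 0" using assms by auto
    have "r * (- B) \<le> 1 * (- B)" using assms \<open>- B > 0\<close> by (intro mult_right_mono) auto
    then have "t * (r * (- B)) \<le> t * \<sigma>" using t \<open>- B \<le> \<sigma>\<close> by (intro mult_left_mono) auto
    moreover have "t * \<sigma> > 0" using t \<open>\<sigma> > 0\<close> by simp
    moreover have "- (r * (t * B)) = t * (r * (- B))"
      by (simp add: algebra_simps)
    ultimately show False using assms(10) st(2) unfolding eq by linarith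
  qed
  then have "r * (t * B) \<ge> 0" using assms t by simp
  then have z: "t * \<sigma> = 0" "s * \<tau> = 0" "r * (t * B) = 0" using assms(10) st unfolding eq by linarith+
  then have "\<sigma> = 0" "s = 0" using t assms(5) by auto
  then show ?thesis using z assms(6) by auto
qed simp

text \<open>This is the form in which connectedness of the norm attainment sets enters. Requiring
  \<open>h 0 = 0\<close> takes care of the zero operator, for which \<open>(0, 0)\<close> is a
  contact pair.\<close>

locale connected_contacts = body_pair +
  assumes not_separates: "continuous_on UNIV h \<Longrightarrow> (\<And>p. h (- p) = h p) \<Longrightarrow> h 0 = 0 \<Longrightarrow> \<not> separates h L"
begin

text \<open>The quadratic form \<open>h\<close> is positive at \<open>a\<close> and negative at
  \<open>b\<close>. The contact pair supplied by \<open>perturbed_contact\<close> maximises the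
  first-order term, so by \<open>cluster_estimate\<close> its point is a multiple of
  \<open>a\<close> or of \<open>b\<close>; there the sign of \<open>h\<close> and the value of
  \<open>r\<close> violate the crossing condition.\<close>

lemma no_two_clusters:
  assumes a: "contact L a f1" and b: "contact L b f2" and one: "f1 \<bullet> mv L a = 1"
    and indep: "cross a b \<noteq> 0" "cross f1 f2 \<noteq> 0"
    and cover: "\<And>p f. contact L p f \<Longrightarrow> \<exists>s t \<sigma> \<tau>. s \<ge> 0 \<and> t \<ge> 0 \<and> \<sigma> \<ge> 0 \<and> \<tau> \<ge> 0 \<and>
      (p = s *\<^sub>R a + t *\<^sub>R b \<and> f = \<sigma> *\<^sub>R f1 + \<tau> *\<^sub>R f2 \<or> - p = s *\<^sub>R a + t *\<^sub>R b \<and> - f = \<sigma> *\<^sub>R f1 + \<tau> *\<^sub>R f2)"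
  shows False
proof -
  obtain a' b' where d: "a' \<bullet> a = 1" "a' \<bullet> b = 0" "b' \<bullet> a = 0" "b' \<bullet> b = 1"
    using dual_basis[OF indep(1)] by metis
  obtain g1 g2 where g: "g1 \<bullet> f1 = 1" "g1 \<bullet> f2 = 0" "g2 \<bullet> f1 = 0" "g2 \<bullet> f2 = 1"
    using dual_basis[OF indep(2)] by metis
  \<comment> \<open>The last term penalises everything strictly between \<open>a\<close> and \<open>b\<close> but neither \<open>(a, f1)\<close> nor \<open>(b, f2)\<close>;
    for \<open>r > 0\<close> the point \<open>b\<close> is penalised as well, for \<open>r < 0\<close> the point \<open>a\<close>.\<close>
  define M where "M r = min r 0 *\<^sub>R rank_one (mv L a) a' + min (- r) 0 *\<^sub>R rank_one (mv L b) b'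
    - 3 *\<^sub>R (rank_one g1 b' + rank_one g2 a')" for r :: real
  define h where "h p = (a' \<bullet> p)\<^sup>2 - (b' \<bullet> p)\<^sup>2" for p
  have V: "f \<bullet> mv (M r) p = min r 0 * ((a' \<bullet> p) * (f \<bullet> mv L a)) + min (- r) 0 * ((b' \<bullet> p) * (f \<bullet> mv L b))
      - 3 * ((b' \<bullet> p) * (g1 \<bullet> f) + (a' \<bullet> p) * (g2 \<bullet> f))" for r p f
    by (simp add: M_def mv_add_left mv_diff_left mv_scaleR_left mv_rank_one inner_add_right
        inner_diff_right inner_commute)
  have "continuous_on {-1..1} M" unfolding M_def by (intro continuous_intros)
  moreover have hc: "continuous_on UNIV h" unfolding h_def by (intro continuous_intros)
  moreover have "\<not> separates h L'" for L' by (rule not_separates[OF hc]) (auto simp: h_def)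
  ultimately obtain r p0 f0 where r: "r \<in> {-1..1}" and c0: "contact L p0 f0"
    and mx0: "\<And>p' f'. contact L p' f' \<Longrightarrow> f' \<bullet> mv (M r) p' \<le> f0 \<bullet> mv (M r) p0"
    and h0: "h p0 = 0 \<or> r = 1 \<and> h p0 \<le> 0 \<or> r = -1 \<and> h p0 \<ge> 0"
    by (rule perturbed_contact) blast
  \<comment> \<open>The cone coordinates exist only up to a common sign of point and functional; the
    first-order term and \<open>h\<close> are invariant under it.\<close>
  obtain s t \<sigma> \<tau> p f where c: "contact L p f" and nn: "s \<ge> 0" "t \<ge> 0" "\<sigma> \<ge> 0" "\<tau> \<ge> 0"
    and pf: "p = s *\<^sub>R a + t *\<^sub>R b" "f = \<sigma> *\<^sub>R f1 + \<tau> *\<^sub>R f2"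
    and sg: "p = p0 \<and> f = f0 \<or> p = - p0 \<and> f = - f0"
    using cover[OF c0] c0 contact_uminus[OF c0] by metis
  have mx: "f' \<bullet> mv (M r) p' \<le> f \<bullet> mv (M r) p" if "contact L p' f'" for p' f'
    using mx0[OF that] sg by (auto simp: mv_minus)
  have h: "h p = 0 \<or> r = 1 \<and> h p \<le> 0 \<or> r = -1 \<and> h p \<ge> 0"
    using h0 sg by (auto simp: h_def)
  have ap: "a' \<bullet> p = s" "b' \<bullet> p = t" "g1 \<bullet> f = \<sigma>" "g2 \<bullet> f = \<tau>"
    using d g by (simp_all add: pf inner_add_right)
  have le1: "f' \<bullet> mv L p' \<le> 1" if "p' \<in> K" "f' \<in> F" for p' f'
    using a one that unfolding contact_def by metis
  have in_KF: "a \<in> K" "b \<in> K" "p \<in> K" "f1 \<in> F" "f2 \<in> F" using a b c unfolding contact_def by auto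
  have one': "f2 \<bullet> mv L b = 1" "f \<bullet> mv L p = 1" using contact_cong a b c one by metis+
  have sA: "s * (f \<bullet> mv L a) + t * (f \<bullet> mv L b) = 1"
    using one'(2) by (simp add: pf(1) mv_add mv_scaleR inner_add_right)
  have sB: "\<sigma> * (f1 \<bullet> mv L p) + \<tau> * (f2 \<bullet> mv L p) = 1"
    using one'(2) by (simp add: pf(2) inner_add_left)
  have st: "\<sigma> + \<tau> \<ge> 1"
    using sB mult_left_mono[OF le1[OF in_KF(3,4)] nn(3)] mult_left_mono[OF le1[OF in_KF(3,5)] nn(4)]
    by linarith
  have low: "f1 \<bullet> mv L b \<ge> -1" "f2 \<bullet> mv L a \<ge> -1"
    using le1[OF in_KF(2) sym_F[OF in_KF(4)]] le1[OF in_KF(1) sym_F[OF in_KF(5)]] by auto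
  have A: "f \<bullet> mv L a \<ge> \<sigma> - \<tau>" "f \<bullet> mv L b \<ge> \<tau> - \<sigma>"
    using one one' mult_left_mono[OF low(1) nn(3)] mult_left_mono[OF low(2) nn(4)]
    by (auto simp: pf(2) inner_add_left)
  have nz: "s \<noteq> 0 \<or> t \<noteq> 0" using sA by auto
  show False
  proof (cases "r \<ge> 0")
    case True
    \<comment> \<open>The competitor \<open>(a, f1)\<close> has first-order term 0 when
      \<open>r \<ge> 0\<close>.\<close>
    have "0 \<le> f \<bullet> mv (M r) p" using mx[OF a] True d g by (simp add: V)
    then have "- r * (t * (f \<bullet> mv L b)) - 3 * (t * \<sigma> + s * \<tau>) \<ge> 0"
      using True by (simp add: V ap min_absorb1 min_absorb2)
    from cluster_estimate[OF nn st sA A(2) True _ this]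
    show False using r h nz True by (auto simp: h_def ap)
  next
    case False
    have "0 \<le> f \<bullet> mv (M r) p" using mx[OF b] False d g by (simp add: V)
    then have "- (- r) * (s * (f \<bullet> mv L a)) - 3 * (s * \<tau> + t * \<sigma>) \<ge> 0"
      using False by (simp add: V ap min_absorb1 min_absorb2)
    \<comment> \<open>The same estimate with \<open>a\<close> and \<open>b\<close> exchanged and
      \<open>- r\<close> for \<open>r\<close>.\<close>
    from cluster_estimate[where A = "f \<bullet> mv L b", OF nn(2,1,4,3) _ _ A(1) _ _ this] st sA r False
    have "s = 0" by (simp add: add.commute)
    then show False using r h nz False by (auto simp: h_def ap)
  qed
qed

end

section \<open>Optimal maps\<close>

text \<open>The functional \<open>f\<close> with coordinates \<open>\<sigma>, \<tau>\<close> norms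
  the image of the point with coordinates \<open>s, t\<close>; \<open>c\<close> is the value of
  \<open>f1\<close> at the image of \<open>b\<close>, and \<open>d\<close> that of \<open>f2\<close>
  at the image of \<open>a\<close>. Since \<open>\<sigma> * (1 - c * d) = A - d * B\<close>, a
  negative \<open>\<sigma>\<close> with \<open>s > 0\<close> would force
  \<open>\<bar>s * d + t\<bar> > 1\<close>. For \<open>s = 0\<close> the bounds give
  \<open>B = 1\<close>, and the last hypothesis, minimality of \<open>f2\<close>, applies.\<close>

lemma cross_sign:
  fixes s t \<sigma> \<tau> c d A B :: real
  assumes "s \<ge> 0" "t \<ge> 0" "s * A + t * B = 1" "\<bar>B\<bar> \<le> 1" "\<bar>s * d + t\<bar> \<le> 1" "c * d < 1"
    and AB: "A = \<sigma> + \<tau> * d" "B = \<sigma> * c + \<tau>" and bd: "B = 1 \<Longrightarrow> A \<ge> d"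
  shows "\<sigma> \<ge> 0"
proof -
  have \<sigma>: "\<sigma> * (1 - c * d) = A - d * B" by (simp add: AB algebra_simps)
  have "A - d * B \<ge> 0"
  proof (cases "s = 0")
    case True
    then have "t * B = 1" "\<bar>t\<bar> \<le> 1" using assms by auto
    then have "B > 0" using assms(2) by (metis mult_not_zero not_le zero_less_mult_pos zero_less_one le_less)
    then have "t * B \<le> 1 * B" using \<open>\<bar>t\<bar> \<le> 1\<close> by (intro mult_right_mono) auto
    then have "B = 1" using \<open>t * B = 1\<close> assms(4) by auto
    then show ?thesis using bd by simp
  next
    case False
    show ?thesis
    proof (rule ccontr)
      assume "\<not> A - d * B \<ge> 0"
      then have "s * A < s * (d * B)" using False assms(1) by (intro mult_strict_left_mono) auto
      then have "1 < B * (s * d + t)" using assms(3) by (simp add: algebra_simps)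
      moreover have "\<bar>B * (s * d + t)\<bar> \<le> 1 * 1" unfolding abs_mult using assms by (intro mult_mono) auto
      ultimately show False by simp
    qed
  qed
  then show ?thesis using \<sigma> assms(6) by (metis diff_gt_0_iff_gt zero_le_mult_iff not_le)
qed

section \<open>Cones in a half-plane\<close>

definition perp :: "plane \<Rightarrow> plane" where "perp x = (- snd x, fst x)"

lemma inner_perp: "perp x \<bullet> y = cross x y" by (simp add: perp_def cross_def inner_prod_def)

text \<open>In the open half-plane given by \<open>m\<close>, directions are ordered by the slope
  \<open>(perp m \<bullet> p) / (m \<bullet> p)\<close>. It is continuous, so its extreme values on
  \<open>S\<close> are attained, and the two points where this happens span a cone around
  \<open>S\<close> unless they are parallel.\<close>

lemma wedge:
  assumes S: "compact S" "S \<noteq> {}" and m: "\<And>x. x \<in> S \<Longrightarrow> m \<bullet> x > 0"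
  obtains x y where "x \<in> S" "y \<in> S" "\<And>p. p \<in> S \<Longrightarrow> cross x p = 0"
  | x y where "x \<in> S" "y \<in> S" "cross x y \<noteq> 0"
    "\<And>p. p \<in> S \<Longrightarrow> \<exists>s t. s \<ge> 0 \<and> t \<ge> 0 \<and> p = s *\<^sub>R x + t *\<^sub>R y"
proof -
  have c: "continuous_on S (\<lambda>p. (perp m \<bullet> p) / (m \<bullet> p))"
    using m by (intro continuous_intros) force
  obtain x where x: "x \<in> S" "\<And>p. p \<in> S \<Longrightarrow> (perp m \<bullet> x) / (m \<bullet> x) \<le> (perp m \<bullet> p) / (m \<bullet> p)"
    using continuous_attains_inf[OF S c] by blast
  obtain y where y: "y \<in> S" "\<And>p. p \<in> S \<Longrightarrow> (perp m \<bullet> p) / (m \<bullet> p) \<le> (perp m \<bullet> y) / (m \<bullet> y)"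
    using continuous_attains_sup[OF S c] by blast
  have mm: "m \<bullet> m > 0" using m[OF x(1)] by auto
  have id: "(m \<bullet> m) * cross u v = (m \<bullet> u) * (perp m \<bullet> v) - (m \<bullet> v) * (perp m \<bullet> u)" for u v
    by (simp add: inner_perp) (simp add: cross_def inner_prod_def algebra_simps)
  have cr: "cross u v \<ge> 0" if "u \<in> S" "v \<in> S" "(perp m \<bullet> u) / (m \<bullet> u) \<le> (perp m \<bullet> v) / (m \<bullet> v)" for u v
  proof -
    have "(perp m \<bullet> u) * (m \<bullet> v) \<le> (perp m \<bullet> v) * (m \<bullet> u)"
      using that m by (simp add: frac_le_eq divide_le_0_iff field_simps)
    then have "(m \<bullet> m) * cross u v \<ge> 0" unfolding id by (simp add: mult.commute)
    then show ?thesis using mm by (simp add: zero_le_mult_iff)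
  qed
  have cp: "cross x p \<ge> 0" "cross p y \<ge> 0" if "p \<in> S" for p using cr x y that by auto
  show ?thesis
  proof (cases "cross x y = 0")
    case True
    have "x \<noteq> 0" using m[OF x(1)] by auto
    from cross_eq_0_imp[OF True this] obtain k where k: "y = k *\<^sub>R x" .
    have "k > 0" using m[OF x(1)] m[OF y(1)] by (auto simp: k zero_less_mult_iff)
    have "cross x p = 0" if "p \<in> S" for p
    proof -
      have "k * cross p x \<ge> 0" using cp(2)[OF that] by (simp add: k)
      then have "cross p x \<ge> 0" using \<open>k > 0\<close> by (simp add: zero_le_mult_iff)
      then show ?thesis using cp(1)[OF that] by (simp add: cross_def algebra_simps)
    qed
    then show ?thesis using that(1) x(1) y(1) by blast
  next
    case False
    then have pos: "cross x y > 0" using cp(1)[OF y(1)] by simp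
    have "\<exists>s t. s \<ge> 0 \<and> t \<ge> 0 \<and> p = s *\<^sub>R x + t *\<^sub>R y" if "p \<in> S" for p
    proof -
      obtain x' y' where d: "x' \<bullet> x = 1" "x' \<bullet> y = 0" "y' \<bullet> x = 0" "y' \<bullet> y = 1"
        and p: "p = (x' \<bullet> p) *\<^sub>R x + (y' \<bullet> p) *\<^sub>R y" using dual_basis[OF False] by metis
      have "cross x p = (y' \<bullet> p) * cross x y" "cross p y = (x' \<bullet> p) * cross x y"
        by (subst p, simp)+
      then have "x' \<bullet> p \<ge> 0" "y' \<bullet> p \<ge> 0" using cp[OF that] pos by (simp_all add: zero_le_mult_iff)
      then show ?thesis using p by blast
    qed
    then show ?thesis using that(2) x(1) y(1) False by blast
  qed
qed

section \<open>Operators maximising a linear functional\<close>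

context body_pair
begin

definition unit_ops :: "(plane \<times> plane) set"
  where "unit_ops = {L. \<forall>p\<in>K. \<forall>f\<in>F. f \<bullet> mv L p \<le> 1}"

lemma unit_opsD: "L \<in> unit_ops \<Longrightarrow> p \<in> K \<Longrightarrow> f \<in> F \<Longrightarrow> f \<bullet> mv L p \<le> 1"
  by (simp only: unit_ops_def mem_Collect_eq)

lemma compact_unit_ops: "compact unit_ops"
proof -
  have "unit_ops = (\<Inter>p\<in>K. \<Inter>f\<in>F. {L. f \<bullet> mv L p \<le> 1})" by (simp add: unit_ops_def set_eq_iff)
  moreover have "closed {L. f \<bullet> mv L p \<le> 1}" for p f
    by (intro closed_Collect_le continuous_intros)
  ultimately have "closed unit_ops" by (simp add: closed_INT)
  moreover have "norm L \<le> 2 / \<delta>\<^sup>2" if L: "L \<in> unit_ops" for L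
  proof -
    have bd: "norm x \<le> 1 / \<delta>\<^sup>2" if x: "\<And>p. p \<in> K \<Longrightarrow> \<delta> * (x \<bullet> p) \<le> 1" for x :: plane
    proof (cases "x = 0")
      case False
      have "(\<delta> / norm x) *\<^sub>R x \<in> K" using delta False by (intro subsetD[OF delta(2)]) simp
      from x[OF this] show ?thesis
        using False delta(1) by (simp add: power2_eq_square power2_norm_eq_inner[symmetric] field_simps)
    qed (simp add: delta)
    have f: "(\<delta>, 0) \<in> F" "(0, \<delta>) \<in> F"
      using delta(1) by (intro subsetD[OF delta(3)]; simp add: norm_Pair)+
    have "norm (fst L) \<le> 1 / \<delta>\<^sup>2" "norm (snd L) \<le> 1 / \<delta>\<^sup>2"
      using unit_opsD[OF L _ f(1)] unit_opsD[OF L _ f(2)] by (intro bd; simp add: mv_def)+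
    then show ?thesis using norm_Pair_le[of "fst L" "snd L"] by simp
  qed
  then have "bounded unit_ops" unfolding bounded_iff by blast
  ultimately show ?thesis by (simp add: compact_eq_bounded_closed)
qed

lemma contactI: "L \<in> unit_ops \<Longrightarrow> p \<in> K \<Longrightarrow> f \<in> F \<Longrightarrow> f \<bullet> mv L p = 1 \<Longrightarrow> contact L p f"
  unfolding contact_def unit_ops_def by simp

definition optimal :: "plane \<times> plane \<Rightarrow> plane \<times> plane \<Rightarrow> bool"
  where "optimal P L \<longleftrightarrow> L \<in> unit_ops \<and> (\<forall>L'\<in>unit_ops. P \<bullet> L' \<le> P \<bullet> L)"

lemma optimal_ex: "\<exists>L. optimal P L"
proof -
  have "0 \<in> unit_ops" by (simp add: unit_ops_def mv_def zero_prod_def[symmetric])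
  then have "unit_ops \<noteq> {}" by blast
  moreover have "continuous_on unit_ops (\<lambda>L. P \<bullet> L)" by (intro continuous_intros)
  ultimately show ?thesis
    using continuous_attains_sup[OF compact_unit_ops] unfolding optimal_def by blast
qed

text \<open>Moving from \<open>L\<close> in the direction \<open>M\<close> increases the pairing
  with \<open>P\<close>, so it must leave \<open>unit_ops\<close>. The pairs at which
  \<open>L + e n *\<^sub>R M\<close> exceeds 1 accumulate at a contact pair of \<open>L\<close>, and
  \<open>M\<close> is nonnegative on them.\<close>

lemma optimal_first_order:
  assumes "optimal P L" "P \<bullet> M > 0"
  obtains p f where "contact L p f" "f \<bullet> mv L p = 1" "f \<bullet> mv M p \<ge> 0"
proof -
  define e where "e n = inverse (real (Suc n))" for n
  have e: "e n > 0" for n by (simp add: e_def)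
  have "\<exists>p f. p \<in> K \<and> f \<in> F \<and> f \<bullet> mv (L + e n *\<^sub>R M) p > 1" for n
  proof (rule ccontr)
    assume "\<nexists>p f. p \<in> K \<and> f \<in> F \<and> f \<bullet> mv (L + e n *\<^sub>R M) p > 1"
    then have "L + e n *\<^sub>R M \<in> unit_ops" unfolding unit_ops_def using not_le by blast
    then have "P \<bullet> (L + e n *\<^sub>R M) \<le> P \<bullet> L" using assms(1) unfolding optimal_def by blast
    then have "e n * (P \<bullet> M) \<le> 0" by (simp add: inner_add_right)
    then show False using e[of n] assms(2) by (simp add: mult_le_0_iff)
  qed
  then obtain p f where pK: "\<And>n. p n \<in> K" and fF: "\<And>n. f n \<in> F"
    and gt: "\<And>n. f n \<bullet> mv (L + e n *\<^sub>R M) (p n) > 1" by metis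
  obtain \<sigma> r0 p0 f0 where *: "strict_mono (\<sigma> :: nat \<Rightarrow> nat)" "(r0::real) \<in> {0..0}" "p0 \<in> K" "f0 \<in> F"
    "(\<lambda>n. p (\<sigma> n)) \<longlonglongrightarrow> p0" "(\<lambda>n. f (\<sigma> n)) \<longlonglongrightarrow> f0"
    by (rule subsequence[of "\<lambda>_. 0" 0 0 p f, OF _ pK fF]) auto
  have elim: "(\<lambda>n. e (\<sigma> n)) \<longlonglongrightarrow> 0"
    using LIMSEQ_subseq_LIMSEQ[OF LIMSEQ_inverse_real_of_nat *(1)] by (simp add: e_def o_def)
  have L: "L \<in> unit_ops" using assms(1) by (simp add: optimal_def)
  have "(\<lambda>n. f (\<sigma> n) \<bullet> mv (L + e (\<sigma> n) *\<^sub>R M) (p (\<sigma> n))) \<longlonglongrightarrow> f0 \<bullet> mv (L + 0 *\<^sub>R M) p0"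
    by (intro tendsto_intros elim *)
  then have "1 \<le> f0 \<bullet> mv (L + 0 *\<^sub>R M) p0"
    by (rule LIMSEQ_le_const) (use gt in \<open>auto intro: less_imp_le\<close>)
  then have one: "f0 \<bullet> mv L p0 = 1" using unit_opsD[OF L *(3,4)] by simp
  have "f n \<bullet> mv M (p n) \<ge> 0" for n
  proof -
    have "e n * (f n \<bullet> mv M (p n)) > 0"
      using gt[of n] unit_opsD[OF L pK fF, of n n] by (simp add: mv_add_left mv_scaleR_left inner_add_right)
    then show ?thesis using e[of n] by (simp add: zero_less_mult_iff)
  qed
  moreover have "(\<lambda>n. f (\<sigma> n) \<bullet> mv M (p (\<sigma> n))) \<longlonglongrightarrow> f0 \<bullet> mv M p0"
    by (intro tendsto_intros *)
  ultimately have "f0 \<bullet> mv M p0 \<ge> 0" using LIMSEQ_le_const by blast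
  then show ?thesis using that contactI[OF L *(3,4) one] one by blast
qed

lemma inner_rank_one: "P \<bullet> rank_one y l = y \<bullet> mv P l"
  by (simp add: rank_one_def mv_def inner_prod_def algebra_simps)

text \<open>The test direction is a multiple of a rank-one map killing \<open>x\<close>, minus
  \<open>L\<close>. As \<open>P\<close> is nonsingular, the multiple can be chosen to make the
  pairing with \<open>P\<close> positive; on a contact point parallel to \<open>x\<close> only
  \<open>- L\<close> remains, with value -1.\<close>

lemma optimal_not_parallel:
  assumes opt: "optimal P L" and P: "cross (fst P) (snd P) \<noteq> 0" and x: "x \<noteq> 0"
  obtains p f where "contact L p f" "f \<bullet> mv L p = 1" "cross x p \<noteq> 0"
proof -
  define z where "z = mv P (perp x)"
  have "z \<noteq> 0"
  proof
    assume "z = 0"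
    then have "cross x (fst P) = 0" "cross x (snd P) = 0"
      by (auto simp: z_def mv_def prod_eq_iff inner_perp[symmetric] inner_commute)
    then obtain c d where "fst P = c *\<^sub>R x" "snd P = d *\<^sub>R x" using cross_eq_0_imp x by metis
    then show False using P by simp
  qed
  define k where "k = (P \<bullet> L + 1) / (z \<bullet> z)"
  have "P \<bullet> (k *\<^sub>R rank_one z (perp x) - L) = 1"
    using \<open>z \<noteq> 0\<close> by (simp add: inner_diff_right inner_rank_one z_def[symmetric] k_def)
  then have "P \<bullet> (k *\<^sub>R rank_one z (perp x) - L) > 0" by simp
  from optimal_first_order[OF opt this] obtain p f where *: "contact L p f" "f \<bullet> mv L p = 1"
    "f \<bullet> mv (k *\<^sub>R rank_one z (perp x) - L) p \<ge> 0" .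
  then have "cross x p \<noteq> 0"
    by (auto simp: mv_diff_left mv_scaleR_left mv_rank_one inner_perp inner_diff_right)
  then show ?thesis using that * by blast
qed

text \<open>Dual to \<open>optimal_not_parallel\<close>: the rank-one map now has its range on the
  line of \<open>perp x\<close>, which functionals parallel to \<open>x\<close> annihilate.\<close>

lemma optimal_not_parallel':
  assumes opt: "optimal P L" and P: "cross (fst P) (snd P) \<noteq> 0" and x: "x \<noteq> 0"
  obtains p f where "contact L p f" "f \<bullet> mv L p = 1" "cross x f \<noteq> 0"
proof -
  define l where "l = fst x *\<^sub>R snd P + (- snd x) *\<^sub>R fst P"
  have l: "perp x \<bullet> mv P q = l \<bullet> q" for q
    by (simp add: l_def mv_def perp_def inner_diff_left)
  have "l \<noteq> 0"
  proof
    assume "l = 0"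
    then have "cross (fst P) l = 0" "cross (snd P) l = 0" by simp_all
    then have "fst x * cross (fst P) (snd P) = 0" "snd x * cross (snd P) (fst P) = 0"
      unfolding l_def cross_add cross_scaleR cross_self by simp_all
    moreover have "cross (snd P) (fst P) = - cross (fst P) (snd P)" by (simp add: cross_def)
    ultimately show False using P x by (auto simp: prod_eq_iff)
  qed
  define k where "k = (P \<bullet> L + 1) / (l \<bullet> l)"
  have "P \<bullet> (k *\<^sub>R rank_one (perp x) l - L) = 1"
    using \<open>l \<noteq> 0\<close> by (simp add: inner_diff_right inner_rank_one l k_def)
  then have "P \<bullet> (k *\<^sub>R rank_one (perp x) l - L) > 0" by simp
  from optimal_first_order[OF opt this] obtain p f where *: "contact L p f" "f \<bullet> mv L p = 1"
    "f \<bullet> mv (k *\<^sub>R rank_one (perp x) l - L) p \<ge> 0" .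
  then have "cross x f \<noteq> 0"
    by (auto simp: mv_diff_left mv_scaleR_left mv_rank_one inner_perp[symmetric] inner_diff_right inner_commute)
  then show ?thesis using that * by blast
qed

end

section \<open>Contact points in every direction\<close>

context connected_contacts
begin

text \<open>If the direction \<open>e\<close> is missed, the contact points with
  \<open>cross e p \<ge> 0\<close> form a compact set \<open>A\<close> in an open half-plane, with
  extreme directions \<open>a\<close> and \<open>b\<close>. The work lies in finding norming
  functionals at \<open>a\<close> and \<open>b\<close> whose cone contains all norming functionals
  along \<open>A\<close>; then \<open>no_two_clusters\<close> applies.\<close>

lemma optimal_contact_every_direction:
  assumes opt: "optimal P L" and P: "cross (fst P) (snd P) \<noteq> 0" and e: "e \<noteq> 0"
  shows "\<exists>p f. contact L p f \<and> cross e p = 0"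
proof (rule ccontr)
  assume "\<nexists>p f. contact L p f \<and> cross e p = 0"
  then have gap: "\<And>p f. contact L p f \<Longrightarrow> cross e p \<noteq> 0" by blast
  have L: "L \<in> unit_ops" using opt by (simp add: optimal_def)
  have one: "f \<bullet> mv L p = 1" if "contact L p f" for p f
    using optimal_not_parallel[OF opt P e] contact_cong that by metis
  define N where "N x = {f \<in> F. f \<bullet> mv L x = 1}" for x
  have compN: "compact (N x)" for x
  proof -
    have "closed {f. f \<bullet> mv L x = 1}" by (intro closed_Collect_eq continuous_intros)
    then have "compact (F \<inter> {f. f \<bullet> mv L x = 1})" by (rule compact_Int_closed[OF compact_F])
    then show ?thesis by (simp only: N_def Int_def mem_Collect_eq)
  qed
  have NI: "f \<in> N p" if "contact L p f" for p f
    using one that unfolding N_def contact_def by blast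
  have ND: "contact L p f" if "p \<in> K" "f \<in> N p" for p f
    using that contactI[OF L] unfolding N_def by blast
  define A where "A = {p \<in> K. cross e p \<ge> 0 \<and> (\<exists>f. contact L p f)}"
  have AI: "p \<in> A" if "contact L p f" "cross e p \<ge> 0" for p f
    using that unfolding A_def contact_def by blast
  have "compact A"
  proof -
    define Z where "Z = (K \<times> F) \<inter> {z. snd z \<bullet> mv L (fst z) = 1} \<inter> {z. perp e \<bullet> fst z \<ge> 0}"
    have "closed {z. snd z \<bullet> mv L (fst z) = 1}" "closed {z. perp e \<bullet> fst z \<ge> 0}"
      by (intro closed_Collect_eq closed_Collect_le continuous_intros)+
    then have "compact Z"
      unfolding Z_def by (intro compact_Int_closed compact_Times compact_K compact_F)
    then have "compact (fst ` Z)" by (intro compact_continuous_image continuous_intros)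
    moreover have "fst ` Z = A"
    proof (intro set_eqI iffI)
      fix p assume "p \<in> fst ` Z"
      then obtain f where "(p, f) \<in> Z" by (metis imageE prod.collapse)
      then have "p \<in> K" "f \<in> F" "f \<bullet> mv L p = 1" "cross e p \<ge> 0" unfolding Z_def inner_perp by auto
      then show "p \<in> A" using contactI[OF L] unfolding A_def by blast
    next
      fix p assume "p \<in> A"
      then obtain f where f: "contact L p f" "cross e p \<ge> 0" unfolding A_def by blast
      then have "(p, f) \<in> Z" using one[OF f(1)] unfolding Z_def contact_def inner_perp by auto
      then show "p \<in> fst ` Z" by force
    qed
    ultimately show ?thesis by simp
  qed
  moreover have "A \<noteq> {}"
  proof -
    obtain p f where "contact L p f" using contact_ex by blast
    then show ?thesis using AI[of p f] AI[of "- p" "- f"] contact_uminus by fastforce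
  qed
  moreover have Apos: "perp e \<bullet> p > 0" if p: "p \<in> A" for p
  proof -
    obtain f where "contact L p f" "cross e p \<ge> 0" using p unfolding A_def by blast
    then show ?thesis using gap[of p f] by (simp add: inner_perp)
  qed
  ultimately obtain a b where ab: "a \<in> A" "b \<in> A" "cross a b \<noteq> 0"
    and wA: "\<And>p. p \<in> A \<Longrightarrow> \<exists>s t. s \<ge> 0 \<and> t \<ge> 0 \<and> p = s *\<^sub>R a + t *\<^sub>R b"
  proof (rule wedge)
    \<comment> \<open>This alternative would put all contact points on one line.\<close>
    fix x y assume x: "x \<in> A" "\<And>p. p \<in> A \<Longrightarrow> cross x p = 0"
    then have "x \<noteq> 0" using Apos[OF x(1)] by auto
    from optimal_not_parallel[OF opt P this] obtain p f where pf: "contact L p f" "cross x p \<noteq> 0" .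
    then have "p \<in> A \<or> - p \<in> A" using AI[of p f] AI[of "- p" "- f"] contact_uminus by fastforce
    then show thesis using x(2)[of p] x(2)[of "- p"] pf(2) by auto
  next
    fix x y assume *: "x \<in> A" "y \<in> A" "cross x y \<noteq> 0"
      "\<And>p. p \<in> A \<Longrightarrow> \<exists>s t. s \<ge> 0 \<and> t \<ge> 0 \<and> p = s *\<^sub>R x + t *\<^sub>R y"
    show thesis by (rule that[OF *])
  qed
  have finish: False if c: "f1 \<in> N a" "f2 \<in> N b" "cross f1 f2 \<noteq> 0"
    and w: "\<And>p f. p \<in> A \<Longrightarrow> f \<in> N p \<Longrightarrow> \<exists>s t. s \<ge> 0 \<and> t \<ge> 0 \<and> f = s *\<^sub>R f1 + t *\<^sub>R f2" for f1 f2
  proof (rule no_two_clusters)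
    show ca: "contact L a f1" and "contact L b f2" using ab(1,2) c ND unfolding A_def by blast+
    show "f1 \<bullet> mv L a = 1" by (rule one[OF ca])
    show "cross a b \<noteq> 0" "cross f1 f2 \<noteq> 0" by fact+
    fix p f assume pf: "contact L p f"
    show "\<exists>s t \<sigma> \<tau>. s \<ge> 0 \<and> t \<ge> 0 \<and> \<sigma> \<ge> 0 \<and> \<tau> \<ge> 0 \<and>
      (p = s *\<^sub>R a + t *\<^sub>R b \<and> f = \<sigma> *\<^sub>R f1 + \<tau> *\<^sub>R f2 \<or> - p = s *\<^sub>R a + t *\<^sub>R b \<and> - f = \<sigma> *\<^sub>R f1 + \<tau> *\<^sub>R f2)"
    proof (cases "cross e p \<ge> 0")
      case True
      then have pA: "p \<in> A" and fN: "f \<in> N p" using AI NI pf by blast+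
      obtain s t where st: "s \<ge> 0" "t \<ge> 0" "p = s *\<^sub>R a + t *\<^sub>R b" using wA[OF pA] by blast
      obtain \<sigma> \<tau> where "\<sigma> \<ge> 0" "\<tau> \<ge> 0" "f = \<sigma> *\<^sub>R f1 + \<tau> *\<^sub>R f2" using w[OF pA fN] by blast
      with st show ?thesis by (intro exI[of _ s] exI[of _ t] exI[of _ \<sigma>] exI[of _ \<tau>]) simp
    next
      case False
      then have "cross e (- p) \<ge> 0" by simp
      then have pA: "- p \<in> A" and fN: "- f \<in> N (- p)" using AI NI contact_uminus[OF pf] by blast+
      obtain s t where st: "s \<ge> 0" "t \<ge> 0" "- p = s *\<^sub>R a + t *\<^sub>R b" using wA[OF pA] by blast
      obtain \<sigma> \<tau> where "\<sigma> \<ge> 0" "\<tau> \<ge> 0" "- f = \<sigma> *\<^sub>R f1 + \<tau> *\<^sub>R f2" using w[OF pA fN] by blast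
      with st show ?thesis by (intro exI[of _ s] exI[of _ t] exI[of _ \<sigma>] exI[of _ \<tau>]) simp
    qed
  qed
  have aK: "a \<in> K" "b \<in> K" using ab unfolding A_def by blast+
  have cpos: "cross e a > 0" "cross e b > 0"
    using Apos ab by (simp_all only: inner_perp)
  have ne: "N a \<noteq> {}" "N b \<noteq> {}" using ab NI unfolding A_def by blast+
  have cont: "continuous_on S (\<lambda>f. f \<bullet> mv L x)" for S x by (intro continuous_intros)
  \<comment> \<open>The outermost choices: \<open>f1\<close> is least on the image of
    \<open>b\<close>, and \<open>f2\<close> on that of \<open>a\<close>. Their minimality supplies
    the last hypothesis of \<open>cross_sign\<close>.\<close>
  obtain f1 where f1: "f1 \<in> N a" "\<And>f. f \<in> N a \<Longrightarrow> f1 \<bullet> mv L b \<le> f \<bullet> mv L b"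
    using continuous_attains_inf[OF compN ne(1) cont[of _ b]] by blast
  obtain f2 where f2: "f2 \<in> N b" "\<And>f. f \<in> N b \<Longrightarrow> f2 \<bullet> mv L a \<le> f \<bullet> mv L a"
    using continuous_attains_inf[OF compN ne(2) cont[of _ a]] by blast
  have NF: "f \<in> F" "f \<bullet> mv L x = 1" if "f \<in> N x" for f x using that unfolding N_def by blast+
  have bd: "\<bar>f \<bullet> mv L p\<bar> \<le> 1" if "f \<in> F" "p \<in> K" for f p
    using unit_opsD[OF L that(2,1)] unit_opsD[OF L that(2) sym_F[OF that(1)]] by auto
  define c d where "c = f1 \<bullet> mv L b" and "d = f2 \<bullet> mv L a"
  have cd: "\<bar>c\<bar> \<le> 1" "\<bar>d\<bar> \<le> 1" using bd NF f1 f2 aK unfolding c_def d_def by blast+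
  have ev1: "f1 \<bullet> mv L a = 1" "f2 \<bullet> mv L b = 1" using NF f1 f2 by blast+
  \<comment> \<open>Otherwise the segment from \<open>b\<close> to \<open>- a\<close>, which lies in \<open>K\<close> and crosses the direction \<open>e\<close>, consists of
    contact points.\<close>
  have "d \<noteq> -1"
  proof
    assume d: "d = -1"
    define l where "l = cross e a / (cross e a + cross e b)"
    have l: "l \<ge> 0" "1 - l \<ge> 0" using cpos by (auto simp: l_def)
    define q where "q = l *\<^sub>R b + (1 - l) *\<^sub>R (- a)"
    have "q \<in> K" unfolding q_def using convexD[OF convex_K aK(2) sym_K[OF aK(1)] l] by simp
    moreover have "f2 \<bullet> mv L q = 1"
      using d ev1 by (simp add: q_def mv_add mv_scaleR mv_minus mv_diff inner_add_right inner_diff_right d_def)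
    ultimately have "contact L q f2" using contactI[OF L] NF f2 by blast
    moreover have "cross e q = 0"
    proof -
      have "cross e q = l * (cross e a + cross e b) - cross e a"
        unfolding q_def cross_add cross_scaleR cross_minus by (simp add: algebra_simps)
      then show ?thesis using cpos by (simp add: l_def)
    qed
    ultimately show False using gap by blast
  qed
  show False
  proof (cases "c = 1 \<and> d = 1")
    case True
    \<comment> \<open>Then \<open>mv L a = mv L b\<close>, and \<open>f1\<close>, \<open>f2\<close> have to be replaced by the extreme norming functionals of this
      common image.\<close>
    have "f \<bullet> mv L b = 1" if "f \<in> N a" for f
      using f1(2)[OF that] True bd[OF NF(1)[OF that] aK(2)] by (simp add: c_def)
    moreover have "f \<bullet> mv L a = 1" if "f \<in> N b" for f
      using f2(2)[OF that] True bd[OF NF(1)[OF that] aK(1)] by (simp add: d_def)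
    ultimately have Nab: "N a = N b" unfolding N_def by blast
    \<comment> \<open>As \<open>f1\<close> has value 1 at the images of both \<open>a\<close> and
      \<open>b\<close>, \<open>s + t \<le> 1\<close>; hence \<open>f\<close> can reach 1 at
      \<open>p\<close> only by reaching it at \<open>a\<close> or at \<open>b\<close>.\<close>
    have Np: "f \<in> N a" if p: "p \<in> A" and f: "f \<in> N p" for p f
    proof -
      obtain s t where st: "s \<ge> 0" "t \<ge> 0" and p': "p = s *\<^sub>R a + t *\<^sub>R b" using wA[OF p] by blast
      have pK: "p \<in> K" using p unfolding A_def by blast
      have "f1 \<bullet> mv L p = s + t" using ev1 True by (simp add: p' mv_add mv_scaleR inner_add_right c_def)
      then have "s + t \<le> 1" using bd[OF NF(1)[OF f1(1)] pK] by simp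
      have eq: "s * (f \<bullet> mv L a) + t * (f \<bullet> mv L b) = 1"
        using NF(2)[OF f] by (simp add: p' mv_add mv_scaleR inner_add_right)
      have le: "f \<bullet> mv L a \<le> 1" "f \<bullet> mv L b \<le> 1" using bd[OF NF(1)[OF f] aK(1)] bd[OF NF(1)[OF f] aK(2)] by simp_all
      have "s * (f \<bullet> mv L a) \<le> s * 1" "t * (f \<bullet> mv L b) \<le> t * 1"
        by (intro mult_left_mono le st)+
      then have "s * (f \<bullet> mv L a) = s" "t * (f \<bullet> mv L b) = t" "s + t = 1"
        using eq \<open>s + t \<le> 1\<close> by linarith+
      then have "f \<bullet> mv L a = 1 \<or> f \<bullet> mv L b = 1" by auto
      then show ?thesis using NF(1)[OF f] Nab unfolding N_def by blast
    qed
    have "mv L a \<bullet> f > 0" if "f \<in> N a" for f using NF(2)[OF that] by (simp add: inner_commute)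
    then obtain g1 g2 where g: "g1 \<in> N a" "g2 \<in> N a" "cross g1 g2 \<noteq> 0"
      and wg: "\<And>f. f \<in> N a \<Longrightarrow> \<exists>s t. s \<ge> 0 \<and> t \<ge> 0 \<and> f = s *\<^sub>R g1 + t *\<^sub>R g2"
    proof (rule wedge[OF compN ne(1)])
      fix x y assume x: "x \<in> N a" "\<And>f. f \<in> N a \<Longrightarrow> cross x f = 0"
      then have "x \<noteq> 0" using NF(2)[OF x(1)] by auto
      from optimal_not_parallel'[OF opt P this] obtain p f where pf: "contact L p f" "cross x f \<noteq> 0" .
      then have "f \<in> N a \<or> - f \<in> N a"
        using AI[of p f] AI[of "- p" "- f"] contact_uminus[OF pf(1)] NI[OF pf(1)] NI[of "- p" "- f"] Np by fastforce
      then show thesis using x(2)[of f] x(2)[of "- f"] pf(2) by auto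
    next
      fix x y assume *: "x \<in> N a" "y \<in> N a" "cross x y \<noteq> 0"
        "\<And>f. f \<in> N a \<Longrightarrow> \<exists>s t. s \<ge> 0 \<and> t \<ge> 0 \<and> f = s *\<^sub>R x + t *\<^sub>R y"
      show thesis by (rule that[OF *])
    qed
    show False using finish[of g1 g2] g wg Np Nab by blast
  next
    case False
    \<comment> \<open>With both moduli at most 1 and \<open>d = -1\<close> excluded,
      \<open>c * d = 1\<close> would require \<open>c = d = 1\<close>.\<close>
    then have cd1: "c * d < 1"
    proof (cases "d = 1")
      case d: False
      then have "\<bar>d\<bar> < 1" using cd \<open>d \<noteq> -1\<close> by linarith
      have "\<bar>c * d\<bar> \<le> 1 * \<bar>d\<bar>" unfolding abs_mult using cd by (intro mult_right_mono) auto
      then show ?thesis using \<open>\<bar>d\<bar> < 1\<close> by linarith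
    qed (use cd in auto)
    have ind: "cross f1 f2 \<noteq> 0"
    proof
      assume "cross f1 f2 = 0"
      moreover have "f1 \<noteq> 0" using ev1 by auto
      ultimately obtain k where k: "f2 = k *\<^sub>R f1" using cross_eq_0_imp by metis
      then have "k * c = 1" "d = k" using ev1 by (auto simp: c_def d_def)
      then show False using cd1 by (simp add: mult.commute)
    qed
    obtain g1 g2 where g: "\<And>f. f = (g1 \<bullet> f) *\<^sub>R f1 + (g2 \<bullet> f) *\<^sub>R f2" using dual_basis[OF ind] by metis
    show False
    proof (rule finish[OF f1(1) f2(1) ind])
      fix p f assume p: "p \<in> A" and f: "f \<in> N p"
      obtain s t where st: "s \<ge> 0" "t \<ge> 0" and p': "p = s *\<^sub>R a + t *\<^sub>R b" using wA[OF p] by blast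
      have pK: "p \<in> K" using p unfolding A_def by blast
      have fF: "f \<in> F" using NF f by blast
      define \<sigma> \<tau> where "\<sigma> = g1 \<bullet> f" and "\<tau> = g2 \<bullet> f"
      have f': "f = \<sigma> *\<^sub>R f1 + \<tau> *\<^sub>R f2" using g[of f] by (simp add: \<sigma>_def \<tau>_def)
      have A1: "f \<bullet> mv L a = \<sigma> + \<tau> * d"
        and A2: "f \<bullet> mv L b = \<sigma> * c + \<tau>"
        using ev1 by (simp_all add: f' inner_add_left c_def d_def)
      have eq: "s * (f \<bullet> mv L a) + t * (f \<bullet> mv L b) = 1"
        using NF(2)[OF f] by (simp add: p' mv_add mv_scaleR inner_add_right)
      have B: "f1 \<bullet> mv L p = s + t * c" "f2 \<bullet> mv L p = s * d + t"
        using ev1 by (simp_all add: p' mv_add mv_scaleR inner_add_right c_def d_def)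
      have "\<sigma> \<ge> 0"
        by (rule cross_sign[OF st eq bd[OF fF aK(2)] _ cd1 A1 A2])
          (use bd[OF NF(1)[OF f2(1)] pK] f2(2)[of f] fF in \<open>auto simp: B d_def N_def\<close>)
      moreover have "\<tau> \<ge> 0"
      proof (rule cross_sign[OF st(2,1) _ bd[OF fF aK(1)]])
        show "t * (f \<bullet> mv L b) + s * (f \<bullet> mv L a) = 1" "d * c < 1"
          using eq cd1 by (simp_all add: add.commute mult.commute)
        show "\<bar>t * c + s\<bar> \<le> 1" using bd[OF NF(1)[OF f1(1)] pK] by (simp add: B add.commute)
        show "f \<bullet> mv L b = \<tau> + \<sigma> * c" "f \<bullet> mv L a = \<tau> * d + \<sigma>"
          using A1 A2 by (simp_all add: add.commute)
        show "c \<le> f \<bullet> mv L b" if "f \<bullet> mv L a = 1"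
          using that f1(2)[of f] fF by (simp add: c_def N_def)
      qed
      ultimately show "\<exists>s t. s \<ge> 0 \<and> t \<ge> 0 \<and> f = s *\<^sub>R f1 + t *\<^sub>R f2" using f' by blast
    qed
  qed
qed

end

section \<open>Invariant quadratic forms\<close>

text \<open>The triple \<open>(a, b, c)\<close> stands for the symmetric matrix with rows
  \<open>(a, b)\<close> and \<open>(b, c)\<close>; \<open>qdet\<close> is its determinant and
  \<open>polar\<close> its action on vectors.\<close>

definition qform :: "real \<times> real \<times> real \<Rightarrow> plane \<Rightarrow> real"
  where "qform A z = fst A * (fst z)\<^sup>2 + 2 * fst (snd A) * fst z * snd z + snd (snd A) * (snd z)\<^sup>2"

definition qdet :: "real \<times> real \<times> real \<Rightarrow> real"
  where "qdet A = fst A * snd (snd A) - (fst (snd A))\<^sup>2"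

definition polar :: "real \<times> real \<times> real \<Rightarrow> plane \<Rightarrow> plane"
  where "polar A y = (fst A * fst y + fst (snd A) * snd y, fst (snd A) * fst y + snd (snd A) * snd y)"

lemma polar_self: "polar A y \<bullet> y = qform A y"
  by (simp add: polar_def qform_def inner_prod_def power2_eq_square algebra_simps)

text \<open>The defect of the inequality is \<open>qdet A\<close> times the square of
  \<open>cross y z\<close>.\<close>

lemma polar_cauchy_schwarz:
  assumes "qdet A \<ge> 0"
  shows "(polar A y \<bullet> z)\<^sup>2 \<le> qform A y * qform A z"
proof -
  have "qform A y * qform A z - (polar A y \<bullet> z)\<^sup>2 = qdet A * (cross y z)\<^sup>2"
    unfolding qform_def polar_def qdet_def cross_def inner_prod_def by (simp add: power2_eq_square algebra_simps)
  then show ?thesis using assms by (metis diff_ge_0_iff_ge zero_le_mult_iff zero_le_power2)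
qed

lemma qform_scaleR: "qform A (c *\<^sub>R z) = c\<^sup>2 * qform A z"
  by (simp add: qform_def power2_eq_square algebra_simps)

text \<open>\<open>B\<close> is the transpose of \<open>M\<close> times \<open>A\<close> times
  \<open>M\<close>, and determinants multiply.\<close>

lemma qform_mv:
  obtains B where "\<And>z. qform B z = qform A (mv M z)" "qdet B = qdet A * (cross (fst M) (snd M))\<^sup>2"
proof
  define a b c d where "a = fst (fst M)" and "b = snd (fst M)" and "c = fst (snd M)" and "d = snd (snd M)"
  note abcd = a_def[symmetric] b_def[symmetric] c_def[symmetric] d_def[symmetric]
  define p q r where "p = fst A" and "q = fst (snd A)" and "r = snd (snd A)"
  note pqr = p_def[symmetric] q_def[symmetric] r_def[symmetric]
  let ?B = "(p * a\<^sup>2 + 2 * q * a * c + r * c\<^sup>2, p * a * b + q * (a * d + b * c) + r * c * d, p * b\<^sup>2 + 2 * q * b * d + r * d\<^sup>2)"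
  show "qform ?B z = qform A (mv M z)" for z
    unfolding qform_def mv_def inner_prod_def fst_conv snd_conv abcd pqr inner_real_def by algebra
  show "qdet ?B = qdet A * (cross (fst M) (snd M))\<^sup>2"
    unfolding qdet_def cross_def fst_conv snd_conv abcd pqr by algebra
qed

text \<open>Up to a positive factor the excess of the midpoint determinant over \<open>D\<close> is
  \<open>D * (a - a')\<^sup>2 + (a * b' - a' * b)\<^sup>2\<close>, in terms of the first two
  coefficients of the forms. This strict concavity makes the Loewner ellipse unique.\<close>

lemma qdet_midpoint_strict:
  assumes "fst A \<ge> 0" "fst B \<ge> 0" "qdet A = D" "qdet B = D" "D > 0" "qdet ((1/2) *\<^sub>R (A + B)) \<le> D"
  shows "A = B"
proof -
  define a b c where "a = fst A" and "b = fst (snd A)" and "c = snd (snd A)"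
  define a' b' c' where "a' = fst B" and "b' = fst (snd B)" and "c' = snd (snd B)"
  have e: "a * c - b\<^sup>2 = D" "a' * c' - b'\<^sup>2 = D"
    using assms by (simp_all add: qdet_def a_def b_def c_def a'_def b'_def c'_def)
  have "a \<noteq> 0" "a' \<noteq> 0" using e assms(5) zero_le_power2[of b] zero_le_power2[of b'] by fastforce+
  then have pos: "a > 0" "a' > 0" using assms(1,2) by (simp_all add: a_def a'_def)
  have "4 * qdet ((1/2) *\<^sub>R (A + B)) = (a + a') * (c + c') - (b + b')\<^sup>2"
    by (simp add: qdet_def a_def b_def c_def a'_def b'_def c'_def power2_eq_square field_simps)
  then have "a * c' + a' * c - 2 * b * b' \<le> 2 * D"
    using e assms(6) by (simp add: power2_eq_square algebra_simps)
  then have "(a * a') * (a * c' + a' * c - 2 * b * b' - 2 * D) \<le> 0"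
    using pos by (intro mult_nonneg_nonpos) auto
  moreover have "(a * a') * (a * c' + a' * c - 2 * b * b' - 2 * D) = D * (a - a')\<^sup>2 + (a * b' - a' * b)\<^sup>2"
  proof -
    have ac: "a * c = D + b\<^sup>2" "a' * c' = D + b'\<^sup>2" using e by simp_all
    have "(a * a') * (a * c' + a' * c - 2 * b * b' - 2 * D) =
        a\<^sup>2 * (a' * c') + a'\<^sup>2 * (a * c) - 2 * a * a' * b * b' - 2 * a * a' * D"
      by (simp add: power2_eq_square algebra_simps)
    then show ?thesis unfolding ac by (simp add: power2_eq_square algebra_simps)
  qed
  ultimately have le: "D * (a - a')\<^sup>2 + (a * b' - a' * b)\<^sup>2 \<le> 0" by simp
  have "D * (a - a')\<^sup>2 \<ge> 0" using assms(5) by simp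
  then have "D * (a - a')\<^sup>2 = 0" "(a * b' - a' * b)\<^sup>2 = 0"
    using le zero_le_power2[of "a * b' - a' * b"] by linarith+
  then have "a = a'" "a * b' = a' * b" using assms(5) by auto
  then have "b = b'" using pos by simp
  then have "c = c'" using e pos \<open>a = a'\<close> by (metis add_diff_cancel_left' diff_add_cancel mult_cancel_left less_irrefl)
  show ?thesis using \<open>a = a'\<close> \<open>b = b'\<close> \<open>c = c'\<close>
    by (simp add: prod_eq_iff a_def b_def c_def a'_def b'_def c'_def)
qed

section \<open>The target norm as the support function of its dual ball\<close>

locale contact_norm = connected_contacts +
  fixes N :: "plane \<Rightarrow> real"
  assumes F_eq: "F = {f. \<forall>y. f \<bullet> y \<le> N y}"
    and norming: "\<exists>f\<in>F. f \<bullet> y = N y"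
    and continuous_N: "continuous_on UNIV N"
begin

lemma F_le: "f \<in> F \<Longrightarrow> f \<bullet> y \<le> N y"
  using F_eq by blast

lemma F_abs_le: "f \<in> F \<Longrightarrow> \<bar>f \<bullet> y\<bar> \<le> N y"
  using F_le[of f y] F_le[OF sym_F, of f y] by auto

lemma N_nonneg: "N y \<ge> 0"
  using norming F_abs_le by (metis abs_ge_zero order_trans)

lemma N_scaleR: "N (c *\<^sub>R y) = \<bar>c\<bar> * N y"
proof (rule antisym)
  obtain f where f: "f \<in> F" "f \<bullet> (c *\<^sub>R y) = N (c *\<^sub>R y)" using norming by blast
  have "N (c *\<^sub>R y) \<le> \<bar>c\<bar> * \<bar>f \<bullet> y\<bar>" using f(2)[symmetric] by (simp add: abs_mult[symmetric])
  also have "\<dots> \<le> \<bar>c\<bar> * N y" using F_abs_le[OF f(1)] by (intro mult_left_mono) auto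
  finally show "N (c *\<^sub>R y) \<le> \<bar>c\<bar> * N y" .
  obtain g where g: "g \<in> F" "g \<bullet> y = N y" using norming by blast
  show "\<bar>c\<bar> * N y \<le> N (c *\<^sub>R y)"
    using F_abs_le[OF g(1), of "c *\<^sub>R y"] g(2) N_nonneg[of y] by (simp add: abs_mult)
qed

lemma N_ge: "\<delta> * norm y \<le> N y"
proof (cases "y = 0")
  case False
  have "(\<delta> / norm y) *\<^sub>R y \<in> F" using delta False by (intro subsetD[OF delta(3)]) simp
  from F_le[OF this, of y] show ?thesis
    using False by (simp add: power2_norm_eq_inner[symmetric] power2_eq_square)
qed (simp add: N_nonneg)

lemma N_pos: "y \<noteq> 0 \<Longrightarrow> N y > 0"
  using N_ge[of y] delta(1) by (smt (verit) mult_pos_pos zero_less_norm_iff)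

text \<open>Equivalently, \<open>N (mv L p)\<close> is the gauge of \<open>K\<close>, so
  \<open>mv L\<close> maps \<open>K\<close> onto the unit ball of \<open>N\<close>. The formulation
  by norming pairs passes to limits.\<close>

definition full :: "plane \<times> plane \<Rightarrow> bool"
  where "full L \<longleftrightarrow> L \<in> unit_ops \<and> (\<forall>e. e \<noteq> 0 \<longrightarrow> (\<exists>p\<in>K. \<exists>f\<in>F. cross e p = 0 \<and> f \<bullet> mv L p = 1))"

lemma optimal_full:
  assumes "optimal P L" "cross (fst P) (snd P) \<noteq> 0"
  shows "full L"
  unfolding full_def
proof (intro conjI allI impI)
  show "L \<in> unit_ops" using assms(1) by (simp add: optimal_def)
  fix e :: plane assume e: "e \<noteq> 0"
  from optimal_contact_every_direction[OF assms e] obtain p f where pf: "contact L p f" "cross e p = 0" by blast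
  obtain p' f' where "contact L p' f'" "f' \<bullet> mv L p' = 1" by (rule optimal_not_parallel[OF assms e])
  then have "f \<bullet> mv L p = 1" using contact_cong[OF pf(1), of p' f'] by simp
  then show "\<exists>p\<in>K. \<exists>f\<in>F. cross e p = 0 \<and> f \<bullet> mv L p = 1" using pf unfolding contact_def by blast
qed

lemma full_limit:
  assumes L: "\<And>n. full (L n)" "L \<longlonglongrightarrow> L0" "L0 \<in> unit_ops"
  shows "full L0"
  unfolding full_def
proof (intro conjI allI impI assms(3))
  fix e :: plane assume e: "e \<noteq> 0"
  have "\<forall>n. \<exists>p f. p \<in> K \<and> f \<in> F \<and> cross e p = 0 \<and> f \<bullet> mv (L n) p = 1"
    using L(1) e unfolding full_def by blast
  then obtain p f where pK: "\<And>n. p n \<in> K" and fF: "\<And>n. f n \<in> F"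
    and c: "\<And>n. cross e (p n) = 0" "\<And>n. f n \<bullet> mv (L n) (p n) = 1" by metis
  obtain \<sigma> r0 p0 f0 where *: "strict_mono (\<sigma> :: nat \<Rightarrow> nat)" "(r0::real) \<in> {0..0}" "p0 \<in> K" "f0 \<in> F"
    "(\<lambda>n. p (\<sigma> n)) \<longlonglongrightarrow> p0" "(\<lambda>n. f (\<sigma> n)) \<longlonglongrightarrow> f0"
    by (rule subsequence[of "\<lambda>_. 0" 0 0 p f, OF _ pK fF]) auto
  have Ls: "(\<lambda>n. L (\<sigma> n)) \<longlonglongrightarrow> L0" using LIMSEQ_subseq_LIMSEQ[OF L(2) *(1)] by (simp add: o_def)
  have "(\<lambda>n. f (\<sigma> n) \<bullet> mv (L (\<sigma> n)) (p (\<sigma> n))) \<longlonglongrightarrow> f0 \<bullet> mv L0 p0"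
    by (intro tendsto_intros * Ls)
  then have "f0 \<bullet> mv L0 p0 = 1" using c(2) by (simp add: LIMSEQ_const_iff)
  moreover have "(\<lambda>n. perp e \<bullet> p (\<sigma> n)) \<longlonglongrightarrow> perp e \<bullet> p0" by (intro tendsto_intros *)
  then have "cross e p0 = 0" using c(1) by (simp add: inner_perp LIMSEQ_const_iff)
  ultimately show "\<exists>p\<in>K. \<exists>f\<in>F. cross e p = 0 \<and> f \<bullet> mv L0 p = 1" using * by blast
qed

text \<open>The value \<open>f \<bullet> mv L p\<close> is the pairing of \<open>L\<close> with a
  singular matrix, so \<open>optimal_full\<close> does not apply directly. Small multiples of
  \<open>rank_one (perp f) (perp p)\<close> make the matrix nonsingular, and fullness survives in
  the limit.\<close>

lemma full_optimal_ex:
  assumes "p \<noteq> 0" "f \<noteq> 0"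
  obtains L where "full L" "\<And>L'. L' \<in> unit_ops \<Longrightarrow> f \<bullet> mv L' p \<le> f \<bullet> mv L p"
proof -
  define P where "P n = rank_one f p + inverse (real (Suc n)) *\<^sub>R rank_one (perp f) (perp p)" for n
  have "cross (fst (P n)) (snd (P n)) = inverse (real (Suc n)) * ((f \<bullet> f) * (p \<bullet> p))" for n
    unfolding P_def rank_one_def cross_def inner_prod_def perp_def
    by (simp add: algebra_simps)
  then have P: "cross (fst (P n)) (snd (P n)) \<noteq> 0" for n using assms by simp
  obtain L where L: "\<And>n. optimal (P n) (L n)" using choice[of "\<lambda>n L. optimal (P n) L"] optimal_ex by blast
  have Lu: "\<And>n. L n \<in> unit_ops" using L by (simp add: optimal_def)
  obtain L0 \<sigma> where L0: "L0 \<in> unit_ops" "strict_mono (\<sigma> :: nat \<Rightarrow> nat)" "(L \<circ> \<sigma>) \<longlonglongrightarrow> L0"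
    using seq_compactE[OF compact_imp_seq_compact[OF compact_unit_ops]] Lu by metis
  have "P \<longlonglongrightarrow> rank_one f p + 0 *\<^sub>R rank_one (perp f) (perp p)"
    unfolding P_def by (intro tendsto_intros LIMSEQ_inverse_real_of_nat)
  from LIMSEQ_subseq_LIMSEQ[OF this L0(2)] have Pl: "(P \<circ> \<sigma>) \<longlonglongrightarrow> rank_one f p" by simp
  have "f \<bullet> mv L' p \<le> f \<bullet> mv L0 p" if "L' \<in> unit_ops" for L'
  proof -
    have "(P \<circ> \<sigma>) n \<bullet> L' \<le> (P \<circ> \<sigma>) n \<bullet> (L \<circ> \<sigma>) n" for n
      using L[of "\<sigma> n"] that unfolding optimal_def by simp
    moreover have "(\<lambda>n. (P \<circ> \<sigma>) n \<bullet> L') \<longlonglongrightarrow> rank_one f p \<bullet> L'"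
      "(\<lambda>n. (P \<circ> \<sigma>) n \<bullet> (L \<circ> \<sigma>) n) \<longlonglongrightarrow> rank_one f p \<bullet> L0"
      by (intro tendsto_intros Pl L0)+
    ultimately have "rank_one f p \<bullet> L' \<le> rank_one f p \<bullet> L0" by (meson LIMSEQ_le)
    then show ?thesis by (simp add: inner_commute[of "rank_one f p"] inner_rank_one)
  qed
  moreover have "full L0"
    by (rule full_limit[OF _ L0(3,1)]) (use optimal_full[OF L P] in simp)
  ultimately show ?thesis using that by blast
qed

text \<open>Rescaled along its line, \<open>p\<close> becomes a point \<open>q\<close> of
  \<open>K\<close> with \<open>N (mv L q) \<ge> 1\<close>, whereas
  \<open>N (mv L' q) \<le> 1\<close>.\<close>

lemma full_maximal:
  assumes "full L" "L' \<in> unit_ops"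
  shows "N (mv L' p) \<le> N (mv L p)"
proof (cases "p = 0")
  case False
  then obtain q f where q: "q \<in> K" "f \<in> F" "cross p q = 0" "f \<bullet> mv L q = 1"
    using assms(1) unfolding full_def by blast
  obtain c where c: "q = c *\<^sub>R p" using cross_eq_0_imp[OF q(3) False] .
  have "c \<noteq> 0" using q(4) by (auto simp: c mv_zero)
  obtain g where g: "g \<in> F" "g \<bullet> mv L' q = N (mv L' q)" using norming by blast
  have "N (mv L' q) \<le> 1" using unit_opsD[OF assms(2) q(1) g(1)] g(2) by simp
  also have "1 \<le> N (mv L q)" using F_le[OF q(2), of "mv L q"] q(4) by simp
  finally show ?thesis using \<open>c \<noteq> 0\<close> by (simp add: c mv_scaleR N_scaleR)
qed (simp add: mv_zero)

lemma full_unit: "full L \<Longrightarrow> L \<in> unit_ops"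
  by (simp add: full_def)

text \<open>Hence \<open>mv L\<close> composed with the inverse of \<open>mv L'\<close> is an
  isometry of \<open>N\<close>.\<close>

lemma full_cong: "full L \<Longrightarrow> full L' \<Longrightarrow> N (mv L p) = N (mv L' p)"
  using full_maximal full_unit by (metis antisym)

lemma full_inverse:
  assumes "full L"
  obtains g where "linear g" "\<And>x. g (mv L x) = x" "\<And>x. mv L (g x) = x"
proof -
  have "x = 0" if x: "mv L x = 0" for x
  proof (rule ccontr)
    assume "x \<noteq> 0"
    then obtain q f where q: "cross x q = 0" "f \<bullet> mv L q = 1" using assms unfolding full_def by blast
    then show False using cross_eq_0_imp[OF q(1) \<open>x \<noteq> 0\<close>] x by (metis mv_scaleR inner_zero_right scaleR_zero_right zero_neq_one)
  qed
  then have "inj (mv L)" using linear_injective_0[OF mv_linear] by blast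
  from linear_injective_isomorphism[OF mv_linear this] show ?thesis using that by blast
qed

section \<open>The Loewner ellipse\<close>

definition subforms where "subforms = {A. \<forall>z. 0 \<le> qform A z \<and> qform A z \<le> (N z)\<^sup>2}"

lemma compact_subforms: "compact subforms"
proof -
  have cl: "closed {A. 0 \<le> qform A z}" "closed {A. qform A z \<le> (N z)\<^sup>2}" for z
    unfolding qform_def by (intro closed_Collect_le continuous_intros)+
  have "subforms = (\<Inter>z. {A. 0 \<le> qform A z} \<inter> {A. qform A z \<le> (N z)\<^sup>2})"
    unfolding subforms_def by blast
  then have "closed subforms" using cl by (metis (no_types, lifting) closed_INT closed_Int)
  moreover have "norm A \<le> 2 * ((N (1,0))\<^sup>2 + (N (0,1))\<^sup>2 + (N (1,1))\<^sup>2)" if A: "A \<in> subforms" for A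
  proof -
    have "0 \<le> qform A z \<and> qform A z \<le> (N z)\<^sup>2" for z using A unfolding subforms_def by blast
    from this[of "(1,0)"] this[of "(0,1)"] this[of "(1,1)"]
    have "0 \<le> fst A" "fst A \<le> (N (1,0))\<^sup>2" "0 \<le> snd (snd A)" "snd (snd A) \<le> (N (0,1))\<^sup>2"
      "0 \<le> fst A + 2 * fst (snd A) + snd (snd A)" "fst A + 2 * fst (snd A) + snd (snd A) \<le> (N (1,1))\<^sup>2"
      by (simp_all add: qform_def)
    moreover have "0 \<le> (N (1,0))\<^sup>2" "0 \<le> (N (0,1))\<^sup>2" "0 \<le> (N (1,1))\<^sup>2" by simp_all
    ultimately have "\<bar>fst A\<bar> + (\<bar>fst (snd A)\<bar> + \<bar>snd (snd A)\<bar>) \<le> 2 * ((N (1,0))\<^sup>2 + (N (0,1))\<^sup>2 + (N (1,1))\<^sup>2)"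
      by (smt (verit))
    moreover have "norm A \<le> \<bar>fst A\<bar> + (\<bar>fst (snd A)\<bar> + \<bar>snd (snd A)\<bar>)"
      using norm_Pair_le[of "fst A" "snd A"] norm_Pair_le[of "fst (snd A)" "snd (snd A)"] by simp
    ultimately show ?thesis by simp
  qed
  then have "bounded subforms" unfolding bounded_iff by blast
  ultimately show ?thesis by (simp add: compact_eq_bounded_closed)
qed

text \<open>The maximiser of \<open>qdet\<close> on \<open>subforms\<close> is unique, so an
  isometry of \<open>N\<close> whose determinant has modulus at least 1 preserves it. The isometries
  \<open>M\<close> and \<open>M'\<close> relating \<open>L\<close> and \<open>L'\<close> are
  mutually inverse, so at least one of them qualifies.\<close>

lemma invariant_form:
  obtains A where "qdet A > 0" "\<And>z. qform A z \<ge> 0"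
    "\<And>L L' p. full L \<Longrightarrow> full L' \<Longrightarrow> qform A (mv L p) = qform A (mv L' p)"
proof -
  \<comment> \<open>A multiple of the Euclidean form shows that the maximal determinant is
    positive.\<close>
  have I: "(\<delta>\<^sup>2, 0, \<delta>\<^sup>2) \<in> subforms"
  proof -
    have "\<delta>\<^sup>2 * (norm z)\<^sup>2 \<le> (N z)\<^sup>2" for z
      using N_ge[of z] delta(1) by (metis power_mono power_mult_distrib mult_nonneg_nonneg norm_ge_zero less_imp_le)
    moreover have "(norm z)\<^sup>2 = (fst z)\<^sup>2 + (snd z)\<^sup>2" for z :: plane
      by (simp add: norm_prod_def)
    ultimately have "qform (\<delta>\<^sup>2, 0, \<delta>\<^sup>2) z \<le> (N z)\<^sup>2" for z by (simp add: qform_def distrib_left)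
    moreover have "0 \<le> qform (\<delta>\<^sup>2, 0, \<delta>\<^sup>2) z" for z by (simp add: qform_def)
    ultimately show ?thesis unfolding subforms_def by blast
  qed
  have "continuous_on subforms qdet" unfolding qdet_def by (intro continuous_intros)
  then obtain A where A: "A \<in> subforms" and mx: "\<And>B. B \<in> subforms \<Longrightarrow> qdet B \<le> qdet A"
    using continuous_attains_sup[OF compact_subforms] I by blast
  have "\<delta>\<^sup>2 * \<delta>\<^sup>2 > 0" using delta(1) by simp
  moreover have "qdet (\<delta>\<^sup>2, 0, \<delta>\<^sup>2) = \<delta>\<^sup>2 * \<delta>\<^sup>2" by (simp add: qdet_def)
  ultimately have D: "qdet A > 0" using mx[OF I] by linarith
  have A0: "\<And>z. 0 \<le> qform A z" and AN: "\<And>z. qform A z \<le> (N z)\<^sup>2" using A unfolding subforms_def by blast+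
  have fst0: "0 \<le> fst B" if "B \<in> subforms" for B
  proof -
    have "0 \<le> qform B (1,0)" using that unfolding subforms_def by blast
    then show ?thesis by (simp add: qform_def)
  qed
  have inv: "qform A (mv M z) = qform A z"
    if M: "\<And>z. N (mv M z) = N z" and det: "(cross (fst M) (snd M))\<^sup>2 \<ge> 1" for M z
  proof -
    obtain B where B: "\<And>z. qform B z = qform A (mv M z)" "qdet B = qdet A * (cross (fst M) (snd M))\<^sup>2"
      using qform_mv by blast
    have Bs: "B \<in> subforms" unfolding subforms_def using A0 AN[of "mv M _"] by (simp add: B(1) M)
    have "qdet B \<ge> qdet A * 1" unfolding B(2) using D det by (intro mult_left_mono) auto
    then have "qdet B = qdet A" using mx[OF Bs] by simp
    moreover have "(1/2) *\<^sub>R (A + B) \<in> subforms"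
    proof -
      have mid: "qform ((1/2) *\<^sub>R (A + B)) z = (qform A z + qform B z) / 2" for z
        by (simp add: qform_def algebra_simps add_divide_distrib)
      have BN: "0 \<le> qform B z" "qform B z \<le> (N z)\<^sup>2" for z using Bs unfolding subforms_def by blast+
      have "0 \<le> qform ((1/2) *\<^sub>R (A + B)) z \<and> qform ((1/2) *\<^sub>R (A + B)) z \<le> (N z)\<^sup>2" for z
        unfolding mid using A0[of z] AN[of z] BN[of z] by simp
      then show ?thesis unfolding subforms_def by blast
    qed
    ultimately have "A = B" using qdet_midpoint_strict[OF fst0[OF A] fst0[OF Bs] refl _ D] mx by blast
    then show ?thesis using B(1) by simp
  qed
  have "qform A (mv L p) = qform A (mv L' p)" if L: "full L" and L': "full L'" for L L' p
  proof -
    obtain g where g: "linear g" "\<And>x. g (mv L x) = x" "\<And>x. mv L (g x) = x" using full_inverse[OF L] by blast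
    obtain g' where g': "linear g'" "\<And>x. g' (mv L' x) = x" "\<And>x. mv L' (g' x) = x" using full_inverse[OF L'] by blast
    obtain M where M: "mv L \<circ> g' = mv M"
      using linear_plane_eq_mv[OF linear_compose[OF g'(1) mv_linear]] by metis
    obtain M' where M': "mv L' \<circ> g = mv M'"
      using linear_plane_eq_mv[OF linear_compose[OF g(1) mv_linear]] by metis
    have Mz: "mv M z = mv L (g' z)" "mv M' z = mv L' (g z)" for z using M M' by (metis comp_apply)+
    have iso: "N (mv M z) = N z" "N (mv M' z) = N z" for z
      using full_cong[OF L L', of "g' z"] full_cong[OF L' L, of "g z"] g g' by (simp_all add: Mz)
    have "mv M (mv M' z) = z" for z by (simp add: Mz g g')
    from this[of "(1,0)"] this[of "(0,1)"]
    have "fst (fst M) * fst (fst M') + snd (fst M) * fst (snd M') = 1"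
      "fst (fst M) * snd (fst M') + snd (fst M) * snd (snd M') = 0"
      "fst (snd M) * fst (fst M') + snd (snd M) * fst (snd M') = 0"
      "fst (snd M) * snd (fst M') + snd (snd M) * snd (snd M') = 1"
      by (auto simp: mv_def inner_prod_def prod_eq_iff)
    then have "cross (fst M) (snd M) * cross (fst M') (snd M') = 1" unfolding cross_def by algebra
    then have "(cross (fst M) (snd M))\<^sup>2 * (cross (fst M') (snd M'))\<^sup>2 = 1"
      by (metis power_mult_distrib power_one)
    then have "(cross (fst M) (snd M))\<^sup>2 \<ge> 1 \<or> (cross (fst M') (snd M'))\<^sup>2 \<ge> 1"
      by (smt (verit) mult_less_cancel_left2 mult_le_one zero_le_power2 mult_strict_mono')
    then show ?thesis
    proof
      assume "(cross (fst M) (snd M))\<^sup>2 \<ge> 1"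
      from inv[OF iso(1) this, of "mv L' p"] show ?thesis by (simp add: Mz g')
    next
      assume "(cross (fst M') (snd M'))\<^sup>2 \<ge> 1"
      from inv[OF iso(2) this, of "mv L p"] show ?thesis by (simp add: Mz g)
    qed
  qed
  then show ?thesis using that[OF D A0] by blast
qed

text \<open>For a unit vector \<open>x\<close> some full \<open>L\<close> moves the preimage of
  \<open>x\<close> under \<open>L0\<close> to a vector where \<open>f\<close> is at least 1. By
  Cauchy-Schwarz the invariant form is at least its maximum \<open>\<rho>\<close> there, and
  invariance carries this bound back to \<open>x\<close>.\<close>

theorem N_quadratic:
  obtains A where "\<And>z. (N z)\<^sup>2 = qform A z"
proof -
  obtain A where D: "qdet A > 0" and A0: "\<And>z. qform A z \<ge> 0"
    and inv: "\<And>L L' p. full L \<Longrightarrow> full L' \<Longrightarrow> qform A (mv L p) = qform A (mv L' p)"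
    using invariant_form by blast
  define S where "S = {z. N z = 1}"
  have "closed S" unfolding S_def by (intro closed_Collect_eq continuous_N continuous_intros)
  moreover have "bounded S"
    unfolding bounded_iff
  proof (intro exI[of _ "1 / \<delta>"] ballI)
    fix z assume "z \<in> S"
    then show "norm z \<le> 1 / \<delta>" using N_ge[of z] delta(1) by (simp add: S_def field_simps)
  qed
  ultimately have "compact S" by (simp add: compact_eq_bounded_closed)
  have nrm: "(1 / N z) *\<^sub>R z \<in> S" if "z \<noteq> 0" for z using N_pos[OF that] by (simp add: S_def N_scaleR)
  have "S \<noteq> {}" using nrm[of "(1,0)"] by (auto simp: prod_eq_iff)
  moreover have "continuous_on S (qform A)" unfolding qform_def by (intro continuous_intros)
  ultimately obtain y where y: "y \<in> S" and mx: "\<And>z. z \<in> S \<Longrightarrow> qform A z \<le> qform A y"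
    using continuous_attains_sup[OF \<open>compact S\<close>] by blast
  define \<rho> where "\<rho> = qform A y"
  have "y \<noteq> 0" using y N_scaleR[of 0 0] by (auto simp: S_def)
  have "\<rho> > 0"
  proof (rule ccontr)
    assume "\<not> \<rho> > 0"
    then have "\<rho> = 0" using A0[of y] by (simp add: \<rho>_def)
    then have "(polar A y \<bullet> z)\<^sup>2 \<le> 0" for z using polar_cauchy_schwarz[of A y z] D by (simp add: \<rho>_def)
    then have "polar A y \<bullet> z = 0" for z by simp
    from this[of "(1,0)"] this[of "(0,1)"] have "fst A * fst y + fst (snd A) * snd y = 0"
      "fst (snd A) * fst y + snd (snd A) * snd y = 0" by (simp_all add: polar_def inner_prod_def)
    then have "qdet A * fst y = 0" "qdet A * snd y = 0" unfolding qdet_def by algebra+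
    then show False using D \<open>y \<noteq> 0\<close> by (simp add: prod_eq_iff)
  qed
  have le: "qform A z \<le> \<rho> * (N z)\<^sup>2" for z
  proof (cases "z = 0")
    case False
    then show ?thesis using mx[OF nrm[OF False]] N_pos[OF False]
      by (simp add: \<rho>_def qform_scaleR power_divide field_simps)
  qed (simp add: qform_def \<open>\<rho> > 0\<close> less_imp_le)
  \<comment> \<open>Cauchy-Schwarz and the maximality of \<open>\<rho>\<close> make this a norming
    functional at \<open>y\<close>.\<close>
  define f where "f = (1 / \<rho>) *\<^sub>R polar A y"
  have fF: "f \<in> F"
    unfolding F_eq
  proof (intro CollectI allI)
    fix z
    have "(polar A y \<bullet> z)\<^sup>2 \<le> \<rho> * qform A z" using polar_cauchy_schwarz[of A y z] D by (simp add: \<rho>_def)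
    also have "\<dots> \<le> \<rho> * (\<rho> * (N z)\<^sup>2)" using le \<open>\<rho> > 0\<close> by (intro mult_left_mono) auto
    also have "\<dots> = (\<rho> * N z)\<^sup>2" by (simp add: power2_eq_square)
    finally have "polar A y \<bullet> z \<le> \<rho> * N z" using \<open>\<rho> > 0\<close> N_nonneg[of z] power2_le_imp_le by fastforce
    then show "f \<bullet> z \<le> N z" using \<open>\<rho> > 0\<close> by (simp add: f_def field_simps)
  qed
  have fy: "f \<bullet> y = 1" using \<open>\<rho> > 0\<close> by (simp add: f_def polar_self \<rho>_def)
  have "f \<noteq> 0" using fy by auto
  \<comment> \<open>Any full map serves as reference; the two arguments only have to be
    nonzero.\<close>
  obtain L0 where L0: "full L0" using full_optimal_ex[OF \<open>y \<noteq> 0\<close> \<open>y \<noteq> 0\<close>] by blast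
  obtain g where g: "linear g" "\<And>x. g (mv L0 x) = x" "\<And>x. mv L0 (g x) = x" using full_inverse[OF L0] by blast
  have ge: "qform A x \<ge> \<rho>" if x: "x \<in> S" for x
  proof -
    obtain h where h: "h \<in> F" "h \<bullet> x = 1" using norming[of x] x by (auto simp only: S_def mem_Collect_eq)
    \<comment> \<open>\<open>l\<close> is \<open>h\<close> pulled back by \<open>mv L0\<close>, so
      \<open>rank_one y l\<close> is an admissible competitor taking \<open>g x\<close> to
      \<open>y\<close>.\<close>
    define l where "l = fst h *\<^sub>R fst L0 + snd h *\<^sub>R snd L0"
    have l: "l \<bullet> p = h \<bullet> mv L0 p" for p by (simp add: l_def mv_def inner_add_left inner_prod_def[of h])
    have "g x \<noteq> 0" using g(3)[of x] h(2) by (auto simp: mv_zero)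
    from full_optimal_ex[OF this \<open>f \<noteq> 0\<close>] obtain L where L: "full L"
      and Lm: "\<And>L'. L' \<in> unit_ops \<Longrightarrow> f \<bullet> mv L' (g x) \<le> f \<bullet> mv L (g x)" by blast
    have "rank_one y l \<in> unit_ops"
      unfolding unit_ops_def
    proof (intro CollectI ballI)
      fix p k assume p: "p \<in> K" and k: "k \<in> F"
      have "\<bar>h \<bullet> mv L0 p\<bar> \<le> 1"
        using unit_opsD[OF full_unit[OF L0] p h(1)] unit_opsD[OF full_unit[OF L0] p sym_F[OF h(1)]] by auto
      moreover have "\<bar>k \<bullet> y\<bar> \<le> 1" using F_abs_le[OF k, of y] y by (simp add: S_def)
      ultimately have "\<bar>(h \<bullet> mv L0 p) * (k \<bullet> y)\<bar> \<le> 1 * 1" unfolding abs_mult by (intro mult_mono) auto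
      then show "k \<bullet> mv (rank_one y l) p \<le> 1" by (simp add: mv_rank_one l)
    qed
    from Lm[OF this] have "f \<bullet> mv L (g x) \<ge> 1" by (simp add: mv_rank_one l g h fy)
    then have "polar A y \<bullet> mv L (g x) \<ge> \<rho>" using \<open>\<rho> > 0\<close> by (simp add: f_def field_simps)
    then have "\<rho>\<^sup>2 \<le> (polar A y \<bullet> mv L (g x))\<^sup>2" using \<open>\<rho> > 0\<close> by (intro power_mono) auto
    also have "\<dots> \<le> \<rho> * qform A (mv L (g x))" using polar_cauchy_schwarz[of A y] D by (simp add: \<rho>_def)
    also have "qform A (mv L (g x)) = qform A x" using inv[OF L L0, of "g x"] g by simp
    finally show ?thesis using \<open>\<rho> > 0\<close> by (simp add: power2_eq_square)
  qed
  have "(N z)\<^sup>2 = qform ((1 / \<rho>) *\<^sub>R A) z" for z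
  proof (cases "z = 0")
    case True
    then show ?thesis using N_scaleR[of 0 0] by (simp add: qform_def)
  next
    case False
    have "\<rho> * (N z)\<^sup>2 \<le> qform A z"
      using ge[OF nrm[OF False]] N_pos[OF False] by (simp add: qform_scaleR power_divide field_simps)
    then have "\<rho> * (N z)\<^sup>2 = qform A z" using le[of z] by simp
    then show ?thesis using \<open>\<rho> > 0\<close> by (simp add: qform_def field_simps)
  qed
  then show ?thesis using that by blast
qed

end

section \<open>Finite-dimensional normed spaces\<close>

text \<open>By induction, the box is a continuous image of the product of an interval and the box of
  one vector fewer.\<close>

lemma compact_coefficient_box:
  assumes "finite B"
  shows "compact ((\<lambda>a. \<Sum>b\<in>B. a b *\<^sub>R (b :: 'a :: real_normed_vector)) ` {a. \<forall>b\<in>B. \<bar>a b\<bar> \<le> 1})"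
  using assms
proof (induction B)
  case empty
  then show ?case by (simp add: image_constant_conv)
next
  case (insert c B)
  let ?box = "\<lambda>B. (\<lambda>a. \<Sum>b\<in>B. a b *\<^sub>R (b :: 'a)) ` {a. \<forall>b\<in>B. \<bar>a b\<bar> \<le> 1}"
  have img: "?box (insert c B) = (\<lambda>z. fst z *\<^sub>R c + snd z) ` ({-1..1} \<times> ?box B)"
  proof (intro set_eqI iffI)
    fix x assume "x \<in> ?box (insert c B)"
    then obtain a where a: "\<forall>b\<in>insert c B. \<bar>a b\<bar> \<le> 1" "x = (\<Sum>b\<in>insert c B. a b *\<^sub>R b)" by blast
    then have "x = a c *\<^sub>R c + (\<Sum>b\<in>B. a b *\<^sub>R b)" using insert by simp
    moreover have "(a c, \<Sum>b\<in>B. a b *\<^sub>R b) \<in> {-1..1} \<times> ?box B"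
      using a(1) by (auto simp: abs_le_iff)
    ultimately show "x \<in> (\<lambda>z. fst z *\<^sub>R c + snd z) ` ({-1..1} \<times> ?box B)" by force
  next
    fix x assume "x \<in> (\<lambda>z. fst z *\<^sub>R c + snd z) ` ({-1..1} \<times> ?box B)"
    then obtain t a where t: "\<bar>t\<bar> \<le> 1" "\<forall>b\<in>B. \<bar>a b\<bar> \<le> 1" "x = t *\<^sub>R c + (\<Sum>b\<in>B. a b *\<^sub>R b)"
      by (auto simp: abs_le_iff)
    have "(\<Sum>b\<in>B. (a(c := t)) b *\<^sub>R b) = (\<Sum>b\<in>B. a b *\<^sub>R b)"
      using insert by (intro sum.cong) auto
    then have "x = (\<Sum>b\<in>insert c B. (a(c := t)) b *\<^sub>R b)" using t insert by simp
    moreover have "a(c := t) \<in> {a. \<forall>b\<in>insert c B. \<bar>a b\<bar> \<le> 1}" using t by auto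
    ultimately show "x \<in> ?box (insert c B)" by blast
  qed
  have "compact ({-1..1::real} \<times> ?box B)" using insert by (intro compact_Times) auto
  then show ?case unfolding img by (rule compact_continuous_image[rotated]) (intro continuous_intros)
qed

text \<open>\<open>S\<close> collects the combinations with one coefficient 1 and the others in
  \<open>[-1, 1]\<close>. It is compact and omits 0 by independence, so norms on it are bounded
  below; dividing by the coefficient of largest modulus reduces everything to
  \<open>S\<close>.\<close>

lemma independent_coefficient_bound:
  fixes B :: "'a :: real_normed_vector set"
  assumes B: "finite B" "independent B"
  obtains \<delta> where "\<delta> > 0" "\<And>a b. b \<in> B \<Longrightarrow> \<delta> * \<bar>a b\<bar> \<le> norm (\<Sum>b\<in>B. a b *\<^sub>R b)"
proof -
  let ?box = "\<lambda>B. (\<lambda>a. \<Sum>b\<in>B. a b *\<^sub>R (b :: 'a)) ` {a. \<forall>b\<in>B. \<bar>a b\<bar> \<le> 1}"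
  define S where "S = (\<Union>b\<in>B. (+) b ` ?box (B - {b}))"
  have "compact S" unfolding S_def
    using B(1) by (intro compact_UN compact_translation compact_coefficient_box) auto
  have "0 \<notin> S"
  proof
    assume "0 \<in> S"
    then obtain b a where b: "b \<in> B" "0 = b + (\<Sum>c\<in>B - {b}. a c *\<^sub>R c)" unfolding S_def by blast
    then have "b = - (\<Sum>c\<in>B - {b}. a c *\<^sub>R c)" by (simp add: eq_neg_iff_add_eq_0)
    moreover have "(\<Sum>c\<in>B - {b}. a c *\<^sub>R c) \<in> span (B - {b})"
      by (intro span_sum span_scale span_base)
    ultimately have "b \<in> span (B - {b})" using span_neg by metis
    then show False using B(2) b(1) unfolding dependent_def by blast
  qed
  obtain \<delta> where \<delta>: "\<delta> > 0" "\<And>x. x \<in> S \<Longrightarrow> \<delta> \<le> norm x"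
  proof (cases "S = {}")
    case False
    obtain x where "x \<in> S" "\<And>y. y \<in> S \<Longrightarrow> norm x \<le> norm y"
      using continuous_attains_inf[OF \<open>compact S\<close> False continuous_on_norm[OF continuous_on_id]] by auto
    then show ?thesis using \<open>0 \<notin> S\<close> by (intro that[of "norm x"]) auto
  qed (use that[of 1] in auto)
  have "\<delta> * \<bar>a b\<bar> \<le> norm (\<Sum>b\<in>B. a b *\<^sub>R b)" if "b \<in> B" for a b
  proof -
    have "Max ((\<lambda>b. \<bar>a b\<bar>) ` B) \<in> (\<lambda>b. \<bar>a b\<bar>) ` B" using B(1) that by (intro Max_in) auto
    then obtain c where "c \<in> B" "\<bar>a c\<bar> = Max ((\<lambda>b. \<bar>a b\<bar>) ` B)" by fastforce
    then have c: "c \<in> B" "\<And>b. b \<in> B \<Longrightarrow> \<bar>a b\<bar> \<le> \<bar>a c\<bar>" using B(1) by auto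
    have "\<delta> * \<bar>a c\<bar> \<le> norm (\<Sum>b\<in>B. a b *\<^sub>R b)"
    proof (cases "a c = 0")
      case False
      have eq: "(\<Sum>b\<in>B. (a b / a c) *\<^sub>R b) = c + (\<Sum>b\<in>B - {c}. (a b / a c) *\<^sub>R b)"
        using c False by (subst sum.remove[OF B(1) c(1)]) simp
      have "(\<lambda>b. a b / a c) \<in> {a. \<forall>b\<in>B - {c}. \<bar>a b\<bar> \<le> 1}" using c False by (simp add: field_simps)
      then have "(\<Sum>b\<in>B. (a b / a c) *\<^sub>R b) \<in> S"
        unfolding S_def eq by (intro UN_I[OF c(1)] imageI)
      moreover have "(\<Sum>b\<in>B. (a b / a c) *\<^sub>R b) = (1 / a c) *\<^sub>R (\<Sum>b\<in>B. a b *\<^sub>R b)"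
        by (simp add: scaleR_sum_right)
      ultimately have "\<delta> \<le> norm ((1 / a c) *\<^sub>R (\<Sum>b\<in>B. a b *\<^sub>R b))" using \<delta>(2) by metis
      then show ?thesis using False by (simp add: field_simps)
    qed simp
    moreover have "\<delta> * \<bar>a b\<bar> \<le> \<delta> * \<bar>a c\<bar>" using c(2)[OF that] \<delta>(1) by simp
    ultimately show ?thesis by linarith
  qed
  then show ?thesis using that \<delta>(1) by blast
qed

lemma finite_dimensional_basis:
  assumes "finite_dimensional TYPE('a::real_normed_vector)"
  obtains B :: "'a::real_normed_vector set" and \<delta> where "finite B" "\<delta> > 0"
    "\<And>x. x = (\<Sum>b\<in>B. representation B x b *\<^sub>R b)"
    "\<And>x b. b \<in> B \<Longrightarrow> \<delta> * \<bar>representation B x b\<bar> \<le> norm x"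
proof -
  obtain C :: "'a set" where C: "finite C" "span C = UNIV" using assms unfolding finite_dimensional_def by blast
  obtain B where B: "B \<subseteq> C" "independent B" "C \<subseteq> span B" using maximal_independent_subset[of C] by blast
  have fB: "finite B" using B C finite_subset by blast
  have "span B = UNIV" using B C by (metis span_mono span_span top.extremum_unique)
  then have rep: "x = (\<Sum>b\<in>B. representation B x b *\<^sub>R b)" for x
    using sum_representation_eq[OF B(2) _ fB order_refl, of x] by simp
  obtain \<delta> where "\<delta> > 0" and \<delta>: "\<And>a b. b \<in> B \<Longrightarrow> \<delta> * \<bar>a b\<bar> \<le> norm (\<Sum>b\<in>B. a b *\<^sub>R b)"
    using independent_coefficient_bound[OF fB B(2)] by blast
  then have "\<delta> * \<bar>representation B x b\<bar> \<le> norm x" if "b \<in> B" for x b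
    using \<delta>[OF that, of "representation B x"] rep[of x] by simp
  then show ?thesis using that[OF fB \<open>\<delta> > 0\<close> rep] by blast
qed

lemma finite_dimensional_bounded_linear:
  fixes T :: "'a::real_normed_vector \<Rightarrow> 'b::real_normed_vector"
  assumes "finite_dimensional TYPE('a)" "linear T"
  shows "bounded_linear T"
proof -
  obtain B :: "'a set" and \<delta> where B: "finite B" "\<delta> > 0" "\<And>x. x = (\<Sum>b\<in>B. representation B x b *\<^sub>R b)"
    "\<And>x b. b \<in> B \<Longrightarrow> \<delta> * \<bar>representation B x b\<bar> \<le> norm x"
    by (rule finite_dimensional_basis[OF assms(1)]) (rule that)
  have "norm (T x) \<le> norm x * (\<Sum>b\<in>B. norm (T b) / \<delta>)" for x
  proof -
    have "T x = T (\<Sum>b\<in>B. representation B x b *\<^sub>R b)" using B(3)[of x] by simp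
    also have "\<dots> = (\<Sum>b\<in>B. representation B x b *\<^sub>R T b)"
      by (simp add: linear_sum[OF assms(2)] linear_scale[OF assms(2)])
    also have "norm \<dots> \<le> (\<Sum>b\<in>B. \<bar>representation B x b\<bar> * norm (T b))"
      by (rule order_trans[OF norm_sum]) simp
    also have "\<dots> \<le> (\<Sum>b\<in>B. norm x / \<delta> * norm (T b))"
      using B(2,4) by (intro sum_mono mult_right_mono) (auto simp: field_simps)
    finally show ?thesis by (simp add: sum_distrib_left)
  qed
  then show ?thesis
    using assms(2) by (intro bounded_linear_intro) (auto simp: linear_add linear_scale)
qed

lemma finite_dimensional_compact_cball:
  assumes "finite_dimensional TYPE('a::real_normed_vector)"
  shows "compact (cball 0 1 :: 'a set)"
proof -
  obtain B :: "'a set" and \<delta> where B: "finite B" "\<delta> > 0" "\<And>x. x = (\<Sum>b\<in>B. representation B x b *\<^sub>R b)"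
    "\<And>x b. b \<in> B \<Longrightarrow> \<delta> * \<bar>representation B x b\<bar> \<le> norm x"
    by (rule finite_dimensional_basis[OF assms]) (rule that)
  define S where "S = (*\<^sub>R) (1 / \<delta>) ` (\<lambda>a. \<Sum>b\<in>B. a b *\<^sub>R b) ` {a. \<forall>b\<in>B. \<bar>a b\<bar> \<le> 1}"
  have "compact S" unfolding S_def using B(1) by (intro compact_scaling compact_coefficient_box)
  moreover have "cball 0 1 \<subseteq> S"
  proof
    fix x :: 'a assume x: "x \<in> cball 0 1"
    have "x = (1 / \<delta>) *\<^sub>R (\<Sum>b\<in>B. (\<delta> * representation B x b) *\<^sub>R b)"
      by (subst B(3)[of x]) (use B(2) in \<open>simp add: scaleR_sum_right\<close>)
    moreover have "\<forall>b\<in>B. \<bar>\<delta> * representation B x b\<bar> \<le> 1"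
      using B(4)[of _ x] B(2) x by (force simp: abs_mult)
    ultimately show "x \<in> S"
      unfolding S_def by (intro image_eqI[of x _ "\<Sum>b\<in>B. (\<delta> * representation B x b) *\<^sub>R b"]
          image_eqI[where x = "\<lambda>b. \<delta> * representation B x b"]) auto
  qed
  ultimately show ?thesis by (metis compact_Int_closed closed_cball inf.absorb_iff2)
qed

section \<open>Norm attainment in Euclidean spaces and on subspaces\<close>

definition attains_on_subspaces :: "'a::real_normed_vector itself \<Rightarrow> bool"
  where "attains_on_subspaces _ \<longleftrightarrow> (\<forall>T::'a \<Rightarrow> 'a. linear T \<longrightarrow>
    (\<exists>V. subspace V \<and> norm_attainment_set T = V \<inter> sphere 0 1))"

definition attains_connectedly :: "'a::real_normed_vector itself \<Rightarrow> bool"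
  where "attains_connectedly _ \<longleftrightarrow> (\<forall>T::'a \<Rightarrow> 'a. linear T \<longrightarrow>
    (\<exists>D. D \<subseteq> sphere 0 1 \<and> connected D \<and> norm_attainment_set T = D \<union> uminus ` D))"

lemma norm_parallelogram:
  fixes x y :: "'a::real_normed_vector"
  assumes "norm_induced_by_inner_product TYPE('a)"
  shows "(norm (x + y))\<^sup>2 + (norm (x - y))\<^sup>2 = 2 * (norm x)\<^sup>2 + 2 * (norm y)\<^sup>2"
proof -
  obtain ip :: "'a \<Rightarrow> 'a \<Rightarrow> real" where ip: "is_inner_product ip" "\<And>x. norm x = sqrt (ip x x)"
    using assms unfolding norm_induced_by_inner_product_def by blast
  have "ip x x \<ge> 0" for x using ip(2)[of x] norm_ge_zero[of x] by (simp add: real_sqrt_ge_0_iff)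
  then have sq: "(norm x)\<^sup>2 = ip x x" for x by (simp add: ip(2))
  have bl: "bilinear ip" using ip(1) unfolding is_inner_product_def by blast
  show ?thesis unfolding sq
    by (simp add: bilinear_ladd[OF bl] bilinear_radd[OF bl] bilinear_lsub[OF bl] bilinear_rsub[OF bl])
qed

lemma euclidean_imp_attains_on_subspaces:
  assumes "is_euclidean_space TYPE('a::real_normed_vector)"
  shows "attains_on_subspaces TYPE('a)"
  unfolding attains_on_subspaces_def
proof (intro allI impI)
  fix T :: "'a \<Rightarrow> 'a" assume T: "linear T"
  have fd: "finite_dimensional TYPE('a)" and ip: "norm_induced_by_inner_product TYPE('a)"
    using assms by (auto simp: is_euclidean_space_def)
  have bl: "bounded_linear T" by (rule finite_dimensional_bounded_linear[OF fd T])
  define V where "V = {x. norm (T x) = onorm T * norm x}"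
  define d where "d x = (onorm T)\<^sup>2 * (norm x)\<^sup>2 - (norm (T x))\<^sup>2" for x
  have d0: "d x \<ge> 0" for x
    using power_mono[OF onorm[OF bl, of x] norm_ge_zero, of 2] by (simp add: d_def power_mult_distrib)
  have V: "x \<in> V \<longleftrightarrow> d x = 0" for x
  proof -
    have "x \<in> V \<longleftrightarrow> (norm (T x))\<^sup>2 = (onorm T * norm x)\<^sup>2"
      unfolding V_def by (simp add: power2_eq_iff_nonneg onorm_pos_le[OF bl])
    then show ?thesis by (auto simp: d_def power_mult_distrib)
  qed
  have "subspace V"
  proof (rule subspaceI)
    show "0 \<in> V" by (simp add: V_def linear_0[OF T])
    show "c *\<^sub>R x \<in> V" if "x \<in> V" for c x using that by (simp add: V_def linear_scale[OF T])
    fix x y assume "x \<in> V" "y \<in> V"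
    \<comment> \<open>\<open>d\<close> inherits the parallelogram law. At zeros \<open>x\<close>,
      \<open>y\<close> of \<open>d\<close> the right side is 0, so both nonnegative summands on the
      left vanish.\<close>
    moreover have "d (x + y) + d (x - y) = 2 * d x + 2 * d y"
    proof -
      have "d (x + y) + d (x - y) = (onorm T)\<^sup>2 * ((norm (x + y))\<^sup>2 + (norm (x - y))\<^sup>2)
        - ((norm (T x + T y))\<^sup>2 + (norm (T x - T y))\<^sup>2)"
        by (simp add: d_def linear_add[OF T] linear_diff[OF T] algebra_simps)
      then show ?thesis unfolding norm_parallelogram[OF ip] by (simp add: d_def algebra_simps)
    qed
    ultimately have "d (x + y) = 0" using d0[of "x + y"] d0[of "x - y"] by (simp add: V)
    then show "x + y \<in> V" by (simp add: V)
  qed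
  moreover have "norm_attainment_set T = V \<inter> sphere 0 1"
    by (auto simp: norm_attainment_set_def V_def)
  ultimately show "\<exists>V. subspace V \<and> norm_attainment_set T = V \<inter> sphere 0 1" by blast
qed

text \<open>Points that are not antipodal are joined by normalising the segment between them, which
  misses 0. Antipodal points are joined through a third one, available among \<open>x\<close> and
  \<open>y\<close>.\<close>

lemma subspace_sphere_connected:
  fixes V :: "'a::real_normed_vector set"
  assumes V: "subspace V" and xy: "x \<in> V \<inter> sphere 0 1" "y \<in> V \<inter> sphere 0 1" "y \<noteq> x" "y \<noteq> - x"
  shows "connected (V \<inter> sphere 0 1)"
proof -
  let ?S = "V \<inter> sphere 0 1"
  have arc: "connected_component ?S z w" if z: "z \<in> ?S" and w: "w \<in> ?S" and ne: "w \<noteq> - z" for z w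
  proof -
    define g where "g t = (1 - t) *\<^sub>R z + t *\<^sub>R w" for t :: real
    have nz: "g t \<noteq> 0" if t: "t \<in> {0..1}" for t
    proof
      assume "g t = 0"
      then have eq: "(1 - t) *\<^sub>R z = - (t *\<^sub>R w)" by (simp add: g_def eq_neg_iff_add_eq_0)
      then have "norm ((1 - t) *\<^sub>R z) = norm (t *\<^sub>R w)" by (metis norm_minus_cancel)
      then have "t = 1 / 2" using z w t by simp
      from eq[unfolded this] have "(1 / 2) *\<^sub>R z = (1 / 2) *\<^sub>R (- w)" by simp
      then have "z = - w" by (simp only: scaleR_cancel_left) simp
      then show False using ne by simp
    qed
    define A where "A = (\<lambda>t. (1 / norm (g t)) *\<^sub>R g t) ` {0..1}"
    have "continuous_on {0..1} g" unfolding g_def by (intro continuous_intros)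
    then have "continuous_on {0..1} (\<lambda>t. (1 / norm (g t)) *\<^sub>R g t)"
      by (intro continuous_intros) (use nz in auto)
    then have "connected A" unfolding A_def by (rule connected_continuous_image) simp
    moreover have "A \<subseteq> ?S"
      using z w nz by (auto simp: A_def g_def intro!: subspace_scale[OF V] subspace_add[OF V])
    moreover have "z \<in> A" "w \<in> A"
      using z w image_eqI[of z "\<lambda>t. (1 / norm (g t)) *\<^sub>R g t" 0 "{0..1}"]
        image_eqI[of w "\<lambda>t. (1 / norm (g t)) *\<^sub>R g t" 1 "{0..1}"]
      by (simp_all add: A_def g_def)
    ultimately show ?thesis unfolding connected_component_def by blast
  qed
  have "connected_component ?S z w" if z: "z \<in> ?S" and w: "w \<in> ?S" for z w
  proof (cases "w = - z")
    case True
    obtain u where u: "u \<in> ?S" "u \<noteq> z" "u \<noteq> - z"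
      using xy z by (metis minus_minus)
    have "connected_component ?S z u" using arc[OF z u(1)] u by blast
    moreover have "connected_component ?S u w" using arc[OF u(1) w] u True by auto
    ultimately show ?thesis by (rule connected_component_trans)
  qed (use arc z w in blast)
  then show ?thesis unfolding connected_iff_connected_component by blast
qed

text \<open>The whole sphere of \<open>V\<close> serves as \<open>D\<close> from dimension 2 on. In
  dimension 1 the sphere is a disconnected pair \<open>{x, - x}\<close> and one point is taken; in
  dimension 0 the empty set.\<close>

lemma attains_on_subspaces_imp_connectedly:
  assumes "attains_on_subspaces TYPE('a::real_normed_vector)"
  shows "attains_connectedly TYPE('a)"
  unfolding attains_connectedly_def
proof (intro allI impI)
  fix T :: "'a \<Rightarrow> 'a" assume "linear T"
  then obtain V where V: "subspace V" and M: "norm_attainment_set T = V \<inter> sphere 0 1"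
    using assms unfolding attains_on_subspaces_def by blast
  let ?S = "V \<inter> sphere 0 1"
  have neg: "- x \<in> ?S" if "x \<in> ?S" for x using that V by (auto simp: subspace_neg)
  show "\<exists>D. D \<subseteq> sphere 0 1 \<and> connected D \<and> norm_attainment_set T = D \<union> uminus ` D"
  proof (cases "\<exists>x\<in>?S. \<exists>y\<in>?S. y \<noteq> x \<and> y \<noteq> - x")
    case True
    then have "connected ?S" using subspace_sphere_connected[OF V] by blast
    moreover have "norm_attainment_set T = ?S \<union> uminus ` ?S" unfolding M using neg by blast
    ultimately show ?thesis by blast
  next
    case False
    show ?thesis
    proof (cases "?S = {}")
      case True
      then show ?thesis using M by (intro exI[of _ "{}"]) auto
    next
      case ne: False
      then obtain x where x: "x \<in> ?S" by blast
      then have "?S = {x, - x}" using False neg[OF x] by blast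
      then show ?thesis using M x by (intro exI[of _ "{x}"]) auto
    qed
  qed
qed

section \<open>Euclidean planes\<close>

text \<open>Hahn-Banach by separation: a hyperplane separating \<open>y\<close> from the open ball
  of radius \<open>N y\<close> gives the functional after rescaling.\<close>

lemma norming_functional:
  fixes N :: "'a::euclidean_space \<Rightarrow> real"
  assumes add: "\<And>x y. N (x + y) \<le> N x + N y" and scale: "\<And>c x. N (c *\<^sub>R x) = \<bar>c\<bar> * N x"
    and pos: "\<And>x. x \<noteq> 0 \<Longrightarrow> N x > 0"
  shows "\<exists>f. (\<forall>x. f \<bullet> x \<le> N x) \<and> f \<bullet> y = N y"
proof (cases "y = 0")
  case True
  have "N x \<ge> 0" for x using pos[of x] scale[of 0 x] by (cases "x = 0") auto
  then show ?thesis using True scale[of 0 0] by (intro exI[of _ 0]) auto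
next
  case False
  define C where "C = {x. N x < N y}"
  have "convex C"
    unfolding convex_def C_def
  proof (intro ballI allI impI CollectI)
    fix u v :: 'a and a b :: real
    assume uv: "u \<in> {x. N x < N y}" "v \<in> {x. N x < N y}" and ab: "a \<ge> 0" "b \<ge> 0" "a + b = 1"
    have "N (a *\<^sub>R u + b *\<^sub>R v) \<le> a * N u + b * N v"
      using add[of "a *\<^sub>R u" "b *\<^sub>R v"] ab by (simp add: scale)
    also have "\<dots> < N y" using uv ab by (intro convex_bound_lt) auto
    finally show "N (a *\<^sub>R u + b *\<^sub>R v) < N y" .
  qed
  moreover have "0 \<in> C" using pos[OF False] scale[of 0 0] by (simp add: C_def)
  then have "C \<noteq> {}" by blast
  moreover have "C \<inter> {y} = {}" by (simp add: C_def)
  ultimately obtain a b where ab: "a \<noteq> 0" "\<And>x. x \<in> C \<Longrightarrow> a \<bullet> x \<le> b" "a \<bullet> y \<ge> b"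
    using separating_hyperplane_sets[of C "{y}"] by auto
  have le: "N y * (a \<bullet> x) \<le> (a \<bullet> y) * N x" for x
  proof (cases "x = 0")
    case True
    then show ?thesis using scale[of 0 0] by simp
  next
    case x: False
    \<comment> \<open>The factor \<open>k < 1\<close> puts the rescaled \<open>x\<close> strictly
      inside the open ball; it then tends to 1.\<close>
    have "k * (N y * (a \<bullet> x)) \<le> (a \<bullet> y) * N x" if k: "0 < k" "k < 1" for k
    proof -
      have "N ((k * N y / N x) *\<^sub>R x) < N y"
        using pos[OF x] pos[OF False] k by (simp add: scale abs_mult)
      then have "(k * N y / N x) * (a \<bullet> x) \<le> a \<bullet> y" using ab(2)[of "(k * N y / N x) *\<^sub>R x"] ab(3) by (simp add: C_def)
      then show ?thesis using pos[OF x] by (simp add: field_simps)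
    qed
    then show ?thesis by (rule field_le_mult_one_interval)
  qed
  have "a \<bullet> y > 0"
  proof -
    have "N y * (a \<bullet> a) > 0" using pos[OF False] ab(1) by simp
    then have "(a \<bullet> y) * N a > 0" using le[of a] by simp
    then show ?thesis using pos[OF ab(1)] by (simp add: zero_less_mult_iff)
  qed
  then show ?thesis using le
    by (intro exI[of _ "(N y / (a \<bullet> y)) *\<^sub>R a"]) (simp add: field_simps)
qed

text \<open>As \<open>h\<close> is even, points of either sign can be taken in \<open>D\<close>
  itself, where the intermediate value theorem applies.\<close>

lemma connected_constant_sign:
  fixes h :: "'a::real_normed_vector \<Rightarrow> real"
  assumes "connected D" "continuous_on UNIV h" "\<And>x. h (- x) = h x"
    and "x \<in> D \<union> uminus ` D" "y \<in> D \<union> uminus ` D" "h x < 0" "h y > 0"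
  obtains z where "z \<in> D" "h z = 0"
proof -
  obtain x' y' where "x' \<in> D" "y' \<in> D" "h x' < 0" "h y' > 0" using assms(3-7) by (metis UnE imageE)
  moreover have "connected (h ` D)"
    using assms(1,2) by (meson connected_continuous_image continuous_on_subset subset_UNIV)
  ultimately have "0 \<in> h ` D" using connectedD_interval[of "h ` D" "h x'" "h y'" 0] by auto
  then show ?thesis using that by force
qed

text \<open>The maps \<open>q\<close> and \<open>j\<close> project onto coordinates of the plane and
  embed it, so each matrix \<open>L\<close> gives the operator \<open>j (mv L (q x))\<close> on the
  whole space. Connectedness of its norm attainment set yields the non-separation property for the
  projected ball \<open>K\<close> and the dual ball \<open>F\<close>.\<close>

lemma plane_norm_quadratic:
  fixes u v :: "'a::real_normed_vector"
  assumes fd: "finite_dimensional TYPE('a)" and att: "attains_connectedly TYPE('a)"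
    and ind: "independent {u, v}" "u \<noteq> v"
  shows "\<exists>A. \<forall>s t. (norm (s *\<^sub>R u + t *\<^sub>R v))\<^sup>2 = qform A (s, t)"
proof -
  obtain f where f: "linear f" "f u = (1::real)" "f v = 0"
    using linear_independent_extend[OF ind(1), of "\<lambda>x. if x = u then 1 else 0"] ind(2) by auto
  obtain g where g: "linear g" "g u = (0::real)" "g v = 1"
    using linear_independent_extend[OF ind(1), of "\<lambda>x. if x = v then 1 else 0"] ind(2) by auto
  define q where "q x = (f x, g x)" for x
  define j where "j z = fst z *\<^sub>R u + snd z *\<^sub>R v" for z :: plane
  define N where "N z = norm (j z)" for z
  have q: "linear q" unfolding q_def using f(1) g(1)
    by (intro linearI) (auto simp: linear_add linear_scale)
  have j: "linear j" unfolding j_def by (intro linearI) (auto simp: algebra_simps)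
  have qj: "q (j z) = z" for z
    by (simp add: q_def j_def linear_add[OF f(1)] linear_add[OF g(1)] linear_scale[OF f(1)] linear_scale[OF g(1)] f g)
  have blq: "bounded_linear q" by (rule finite_dimensional_bounded_linear[OF fd q])
  then have contq: "continuous_on S q" for S by (rule linear_continuous_on)
  obtain M where M: "M > 0" "\<And>x. norm (q x) \<le> norm x * M" using bounded_linear.pos_bounded[OF blq] by blast
  define c where "c = norm u + norm v + 1"
  have c: "c > 0" unfolding c_def by (smt (verit) norm_ge_zero)
  have Nc: "N z \<le> c * norm z" for z
  proof -
    have "N z \<le> \<bar>fst z\<bar> * norm u + \<bar>snd z\<bar> * norm v"
      unfolding N_def j_def by (rule order_trans[OF norm_triangle_ineq]) simp
    also have "\<dots> \<le> norm z * norm u + norm z * norm v"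
      using norm_fst_le[of "fst z" "snd z"] norm_snd_le[of "snd z" "fst z"] by (intro add_mono mult_right_mono) auto
    also have "\<dots> \<le> c * norm z" by (simp add: c_def algebra_simps)
    finally show ?thesis .
  qed
  have NM: "norm z \<le> N z * M" for z using M(2)[of "j z"] by (simp add: qj N_def)
  have Nadd: "N (x + y) \<le> N x + N y" for x y unfolding N_def linear_add[OF j] by (rule norm_triangle_ineq)
  have Nscale: "N (k *\<^sub>R x) = \<bar>k\<bar> * N x" for k x unfolding N_def linear_scale[OF j] by simp
  have Nneg: "N (- x) = N x" for x unfolding N_def linear_neg[OF j] by simp
  have Npos: "N x > 0" if "x \<noteq> 0" for x
  proof -
    have "0 < norm x" using that by simp
    also have "\<dots> \<le> N x * M" by (rule NM)
    finally show ?thesis using M(1) by (simp add: zero_less_mult_iff)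
  qed
  define K where "K = q ` cball 0 1"
  define F where "F = {f. \<forall>y. f \<bullet> y \<le> N y}"
  \<comment> \<open>The radius \<open>1 / c\<close> works for \<open>K\<close> by \<open>Nc\<close>,
    and \<open>1 / M\<close> for \<open>F\<close> by \<open>NM\<close>.\<close>
  define \<delta> where "\<delta> = min (1 / c) (1 / M)"
  have norming: "\<exists>f\<in>F. f \<bullet> y = N y" for y
    using norming_functional[of N y, OF Nadd Nscale Npos] unfolding F_def by blast
  have FN: "f \<bullet> y \<le> N y" if "f \<in> F" for f y using that unfolding F_def by blast
  interpret body_pair K F \<delta>
  proof
    show "compact K" unfolding K_def
      by (rule compact_continuous_image[OF contq finite_dimensional_compact_cball[OF fd]])
    show "convex K" unfolding K_def by (rule convex_linear_image[OF q convex_cball])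
    show "- p \<in> K" if p: "p \<in> K" for p
    proof -
      obtain x where "x \<in> cball 0 1" "p = q x" using p unfolding K_def by blast
      then show ?thesis unfolding K_def by (intro image_eqI[of _ _ "- x"]) (auto simp: linear_neg[OF q])
    qed
    have "F = (\<Inter>y. {f. f \<bullet> y \<le> N y})" unfolding F_def by blast
    moreover have "closed {f. f \<bullet> y \<le> N y}" for y by (intro closed_Collect_le continuous_intros)
    ultimately have "closed F" by (metis (no_types, lifting) closed_INT)
    moreover have "norm f \<le> c" if "f \<in> F" for f
    proof -
      have "norm f * norm f \<le> c * norm f"
        using FN[OF that, of f] Nc[of f] by (simp add: power2_norm_eq_inner[symmetric] power2_eq_square)
      then show ?thesis using c by (cases "f = 0") auto
    qed
    then have "bounded F" unfolding bounded_iff by blast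
    ultimately show "compact F" by (simp add: compact_eq_bounded_closed)
    show "- f \<in> F" if "f \<in> F" for f
    proof -
      have "- f \<bullet> y \<le> N y" for y using FN[OF that, of "- y"] by (simp add: Nneg)
      then show ?thesis unfolding F_def by blast
    qed
    show "0 < \<delta>" using c M(1) by (simp add: \<delta>_def)
    show "cball 0 \<delta> \<subseteq> K"
    proof
      fix z :: plane assume "z \<in> cball 0 \<delta>"
      then have "norm z \<le> 1 / c" by (simp add: \<delta>_def)
      then have "norm (j z) \<le> 1" using Nc[of z] c by (simp add: N_def field_simps)
      then show "z \<in> K" unfolding K_def by (intro image_eqI[of _ _ "j z"]) (auto simp: qj)
    qed
    show "cball 0 \<delta> \<subseteq> F"
    proof
      fix z :: plane assume "z \<in> cball 0 \<delta>"
      then have z: "norm z * M \<le> 1" using M(1) by (simp add: \<delta>_def field_simps)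
      have "z \<bullet> y \<le> N y" for y
      proof -
        have "z \<bullet> y \<le> norm z * norm y" by (rule norm_cauchy_schwarz)
        also have "\<dots> \<le> norm z * (N y * M)" using NM by (intro mult_left_mono) auto
        also have "\<dots> = (norm z * M) * N y" by simp
        also have "\<dots> \<le> 1 * N y" using z by (intro mult_right_mono) (auto simp: N_def)
        finally show ?thesis by simp
      qed
      then show "z \<in> F" unfolding F_def by blast
    qed
  qed
  have nosep: "\<not> separates h L" if h: "continuous_on UNIV h" "\<And>p. h (- p) = h p" "h 0 = 0" for h L
  proof
    assume sep: "separates h L"
    define T where "T x = j (mv L (q x))" for x
    have "linear T" unfolding T_def
      by (intro linearI) (simp_all add: linear_add[OF q] linear_scale[OF q] mv_add mv_scaleR linear_add[OF j] linear_scale[OF j])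
    then obtain D where D: "connected D" "norm_attainment_set T = D \<union> uminus ` D"
      using att unfolding attains_connectedly_def by blast
    have blT: "bounded_linear T" by (rule finite_dimensional_bounded_linear[OF fd \<open>linear T\<close>])
    have NT: "norm (T x) = N (mv L (q x))" for x by (simp add: T_def N_def)
    obtain p1 f1 p2 f2 where sp: "contact L p1 f1" "h p1 < 0" "contact L p2 f2" "h p2 > 0"
      using sep unfolding separates_def by blast
    have nz: "h p \<noteq> 0" if "contact L p f" for p f using sep that unfolding separates_def by blast
    define m where "m = f1 \<bullet> mv L p1"
    have mle: "f \<bullet> mv L p \<le> m" if "p \<in> K" "f \<in> F" for p f
      using sp(1) that unfolding contact_def m_def by blast
    have m_contact: "contact L p f" if "p \<in> K" "f \<in> F" "f \<bullet> mv L p = m" for p f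
      using mle that unfolding contact_def by simp
    have "0 \<in> K" "0 \<in> F" using delta by auto
    then have "m \<ge> 0" using mle[of 0 0] by simp
    moreover have "m \<noteq> 0"
    proof
      assume "m = 0"
      then have "contact L 0 0" using m_contact \<open>0 \<in> K\<close> \<open>0 \<in> F\<close> by simp
      then show False using nz h(3) by blast
    qed
    ultimately have m: "m > 0" by simp
    have T1: "norm (T x) \<le> m" if "norm x \<le> 1" for x
    proof -
      obtain f where "f \<in> F" "f \<bullet> mv L (q x) = N (mv L (q x))" using norming by blast
      moreover have "q x \<in> K" using that unfolding K_def by simp
      ultimately show ?thesis using mle unfolding NT by metis
    qed
    have "norm (T x) \<le> m * norm x" for x
    proof (cases "x = 0")
      case False
      have "norm (T ((1 / norm x) *\<^sub>R x)) \<le> m" using False by (intro T1) simp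
      then show ?thesis using False by (simp add: linear_scale[OF \<open>linear T\<close>] field_simps)
    qed (simp add: linear_0[OF \<open>linear T\<close>])
    then have onle: "onorm T \<le> m" using m by (intro onorm_bound) auto
    \<comment> \<open>A preimage \<open>x\<close> in the unit ball satisfies
      \<open>m \<le> onorm T * norm x \<le> m * norm x\<close>, so it has norm 1 and attains the
      norm of \<open>T\<close>.\<close>
    have lift: "\<exists>x\<in>norm_attainment_set T. q x = p" if pf: "contact L p f" for p f
    proof -
      have "p \<in> K" using pf unfolding contact_def by blast
      then obtain x where x: "x \<in> cball 0 1" "q x = p" unfolding K_def by blast
      have "f \<bullet> mv L p = m" using contact_cong[OF pf sp(1)] by (simp add: m_def)
      moreover have "f \<in> F" using pf unfolding contact_def by blast
      ultimately have "m \<le> norm (T x)" using FN[of f "mv L p"] by (simp add: NT x)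
      also have "\<dots> \<le> onorm T * norm x" by (rule onorm[OF blT])
      finally have 1: "m \<le> onorm T * norm x" .
      also have "\<dots> \<le> m * norm x" using onle by (intro mult_right_mono) auto
      finally have "norm x = 1" using m x(1) by simp
      moreover have "norm (T x) = onorm T"
        using 1 \<open>m \<le> norm (T x)\<close> T1[of x] \<open>norm x = 1\<close> onle by simp
      ultimately show ?thesis using x(2) by (auto simp: norm_attainment_set_def)
    qed
    obtain x1 x2 where x: "x1 \<in> norm_attainment_set T" "q x1 = p1" "x2 \<in> norm_attainment_set T" "q x2 = p2"
      using lift sp by metis
    have "onorm T = m"
    proof -
      have "norm (T x1) = onorm T" using x(1) by (simp add: norm_attainment_set_def)
      moreover have "f1 \<in> F" using sp(1) unfolding contact_def by blast
      then have "m \<le> norm (T x1)" using FN[of f1 "mv L p1"] by (simp add: NT x m_def)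
      ultimately show ?thesis using onle by simp
    qed
    have "continuous_on UNIV (\<lambda>x. h (q x))"
      using continuous_on_compose2[OF h(1) contq[of UNIV]] by simp
    moreover have "h (q (- x)) = h (q x)" for x by (simp add: linear_neg[OF q] h(2))
    ultimately obtain z where z: "z \<in> D" "h (q z) = 0"
      using connected_constant_sign[OF D(1), of "\<lambda>x. h (q x)" x1 x2] x sp D(2) by metis
    then have zM: "z \<in> norm_attainment_set T" using D(2) by blast
    obtain f where f: "f \<in> F" "f \<bullet> mv L (q z) = N (mv L (q z))" using norming by blast
    moreover have "N (mv L (q z)) = m" using zM \<open>onorm T = m\<close> by (simp add: norm_attainment_set_def NT)
    moreover have "q z \<in> K" using zM by (auto simp: norm_attainment_set_def K_def)
    ultimately have "contact L (q z) f" using m_contact by simp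
    then show False using nz z(2) by blast
  qed
  interpret contact_norm K F \<delta> N
  proof
    show "\<not> separates h L" if "continuous_on UNIV h" "\<And>p. h (- p) = h p" "h 0 = 0" for h L
      using nosep that by blast
    show "F = {f. \<forall>y. f \<bullet> y \<le> N y}" by (rule F_def)
    show "\<exists>f\<in>F. f \<bullet> y = N y" for y by (rule norming)
    show "continuous_on UNIV N" unfolding N_def j_def by (intro continuous_intros)
  qed
  obtain A where "\<And>z. (N z)\<^sup>2 = qform A z" using N_quadratic by blast
  from this[of "(_, _)"] have "(norm (s *\<^sub>R u + t *\<^sub>R v))\<^sup>2 = qform A (s, t)" for s t
    by (simp add: N_def j_def)
  then show ?thesis by blast
qed

section \<open>From planes to an inner product\<close>

text \<open>Polarisation. Homogeneity and the parallelogram law concern two vectors and are read off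
  from the form on their plane. Additivity concerns three and follows from the parallelogram law as
  in the Jordan-von Neumann theorem.\<close>

lemma inner_product_of_quadratic_planes:
  assumes "\<And>u v :: 'a::real_normed_vector. \<exists>A. \<forall>s t. (norm (s *\<^sub>R u + t *\<^sub>R v))\<^sup>2 = qform A (s, t)"
  shows "norm_induced_by_inner_product TYPE('a)"
proof -
  define ip where "ip x y = ((norm (x + y))\<^sup>2 - (norm (x - y))\<^sup>2) / 4" for x y :: 'a
  have form: "\<exists>a b c. \<forall>s t. (norm (s *\<^sub>R x + t *\<^sub>R y))\<^sup>2 = a * s\<^sup>2 + 2 * b * s * t + c * t\<^sup>2" for x y :: 'a
    using assms[of x y] unfolding qform_def fst_conv snd_conv by blast
  have plg: "(norm (x + y))\<^sup>2 + (norm (x - y))\<^sup>2 = 2 * (norm x)\<^sup>2 + 2 * (norm y)\<^sup>2" for x y :: 'a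
  proof -
    obtain a b c where F: "\<And>s t. (norm (s *\<^sub>R x + t *\<^sub>R y))\<^sup>2 = a * s\<^sup>2 + 2 * b * s * t + c * t\<^sup>2"
      using form[of x y] by blast
    show ?thesis using F[of 1 1] F[of 1 "-1"] F[of 1 0] F[of 0 1] by simp
  qed
  have sym: "ip x y = ip y x" for x y by (simp add: ip_def add.commute norm_minus_commute)
  have scale: "ip (k *\<^sub>R x) y = k * ip x y" for k x y
  proof -
    obtain a b c where F: "\<And>s t. (norm (s *\<^sub>R x + t *\<^sub>R y))\<^sup>2 = a * s\<^sup>2 + 2 * b * s * t + c * t\<^sup>2"
      using form[of x y] by blast
    have "ip (k *\<^sub>R x) y = k * b" for k using F[of k 1] F[of k "-1"] by (simp add: ip_def)
    from this[of k] this[of 1] show ?thesis by simp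
  qed
  have half: "ip (x + z) y + ip (x - z) y = 2 * ip x y" for x y z
  proof -
    \<comment> \<open>The parallelogram law is applied to \<open>x + y\<close>, \<open>z\<close> and
      to \<open>x - y\<close>, \<open>z\<close>; the norm of \<open>z\<close> cancels.\<close>
    have e: "x + z + y = (x + y) + z" "x + z - y = (x - y) + z" "x - z + y = (x + y) - z" "x - z - y = (x - y) - z"
      by simp_all
    have "(A - B) / 4 + (C - D) / 4 = 2 * ((E - G) / 4)"
      if "A + C = 2 * E + 2 * Z" "B + D = 2 * G + 2 * Z" for A B C D E G Z :: real
      using that by (simp add: field_simps)
    then show ?thesis unfolding ip_def e using plg[of "x + y" z] plg[of "x - y" z] by blast
  qed
  have add: "ip (x + z) y = ip x y + ip z y" for x y z
  proof -
    define a b where "a = (1 / 2) *\<^sub>R (x + z)" and "b = (1 / 2) *\<^sub>R (x - z)"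
    have "a + b = x" "a - b = z"
      by (simp_all add: a_def b_def scaleR_add_right[symmetric] scaleR_diff_right[symmetric] del: scaleR_add_right scaleR_diff_right)
    then have "ip x y + ip z y = 2 * ip a y" using half[of a b y] by simp
    then show ?thesis by (simp add: a_def scale)
  qed
  have "bilinear ip"
    unfolding bilinear_def
    by (intro conjI allI linearI)
      (simp_all add: add scale sym[of _ "_ + _"] sym[of _ "_ *\<^sub>R _"], simp_all add: sym)
  moreover have self: "ip x x = (norm x)\<^sup>2" for x
    by (simp add: ip_def scaleR_2[symmetric] power_mult_distrib)
  ultimately have "is_inner_product ip" using sym by (simp add: is_inner_product_def)
  moreover have "norm x = sqrt (ip x x)" for x by (simp add: self)
  ultimately show ?thesis unfolding norm_induced_by_inner_product_def by blast
qed

lemma attains_connectedly_imp_euclidean: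
  assumes fd: "finite_dimensional TYPE('a::real_normed_vector)" and att: "attains_connectedly TYPE('a)"
  shows "is_euclidean_space TYPE('a)"
proof -
  have "\<exists>A. \<forall>s t. (norm (s *\<^sub>R u + t *\<^sub>R v))\<^sup>2 = qform A (s, t)" for u v :: 'a
  proof (cases "\<exists>w a b. u = a *\<^sub>R w \<and> v = b *\<^sub>R w")
    case True
    \<comment> \<open>On a line the squared norm is a multiple of the square of a linear form, a
      degenerate case of \<open>qform\<close>.\<close>
    then obtain w a b where "u = a *\<^sub>R w" "v = b *\<^sub>R w" by blast
    then have "s *\<^sub>R u + t *\<^sub>R v = (s * a + t * b) *\<^sub>R w" for s t by (simp add: algebra_simps)
    then have "(norm (s *\<^sub>R u + t *\<^sub>R v))\<^sup>2 = qform ((norm w)\<^sup>2 * a\<^sup>2, (norm w)\<^sup>2 * a * b, (norm w)\<^sup>2 * b\<^sup>2) (s, t)" for s t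
      by (simp add: qform_def power_mult_distrib) (simp add: power2_eq_square algebra_simps)
    then show ?thesis by blast
  next
    case False
    have "v \<noteq> k *\<^sub>R u" for k using False by (metis scaleR_one)
    then have "u \<noteq> v" "v \<notin> span {u}" by (metis scaleR_one, auto simp: span_singleton)
    moreover have "u \<noteq> 0" using False by (metis scaleR_zero_left scaleR_one)
    ultimately have "independent {u, v}"
      by (metis independent_insert insert_commute dependent_single independent_empty empty_iff singletonD)
    then show ?thesis using plane_norm_quadratic[OF fd att] \<open>u \<noteq> v\<close> by blast
  qed
  then show ?thesis using inner_product_of_quadratic_planes fd by (auto simp: is_euclidean_space_def)
qed

theorem theorem2p3:
  assumes "finite_dimensional TYPE('a::banach)"
  shows "((\<forall>T::'a \<Rightarrow> 'a. linear T \<longrightarrow>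
             (\<exists>V. subspace V \<and> norm_attainment_set T = V \<inter> sphere 0 1))
          \<longleftrightarrow>
          (\<forall>T::'a \<Rightarrow> 'a. linear T \<longrightarrow>
             (\<exists>D. D \<subseteq> sphere 0 1 \<and> connected D \<and>
                  norm_attainment_set T = D \<union> uminus ` D)))
       \<and> ((\<forall>T::'a \<Rightarrow> 'a. linear T \<longrightarrow>
             (\<exists>D. D \<subseteq> sphere 0 1 \<and> connected D \<and>
                  norm_attainment_set T = D \<union> uminus ` D))
          \<longleftrightarrow> is_euclidean_space TYPE('a))"
  using attains_on_subspaces_imp_connectedly[where 'a = 'a]
    attains_connectedly_imp_euclidean[OF assms] euclidean_imp_attains_on_subspaces[where 'a = 'a]
  unfolding attains_on_subspaces_def attains_connectedly_def by blast

end
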